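(* Let $\kappa>\aleph_0$ be a cardinal. If an infinite $\mathsf{T}_1$ topological space $X$ is weakly Lindelöf, then in the generic extension $V^{\mathbb{C}(\kappa)}$ player ONE has no winning strategy in the game $\mathsf{G}_1^{\omega}(\mathcal{O},\mathcal{D})$ on $X$.
   Context: $\mathbb{C}(\kappa)$ is the partially ordered set for adding $\kappa$ Cohen reals: its elements are the finite functions $p$ with domain a subset of $\kappa\times\omega$ and values in $\omega$, ordered by $p<q$ if $q\subset p$. $V^{\mathbb{C}(\kappa)}$ denotes the forcing extension of the ground model $V\models\mathsf{ZFC}$ by $\mathbb{C}(\kappa)$; a statement holds in $V^{\mathbb{C}(\kappa)}$ if it is forced by $\mathbf{1}_{\mathbb{C}(\kappa)}$. A ground model space $(X,\tau)$ is regarded in the extension as the set $X$ with the topology having $\tau$ as a base. A space is weakly Lindelöf if each open cover contains a countable subset whose union is dense in the space. For a topological space $X$: $\mathcal{O}$ is the collection of all open covers of $X$; $\mathcal{D}$ is the collection of families of open subsets of $X$ whose union is dense in $X$. The game $\mathsf{G}_1^{\omega}(\mathcal{A},\mathcal{B})$: players ONE and TWO play an inning for each $n\in\omega$. In inning $n$ ONE first selects $O_n\in\mathcal{A}$, then TWO responds with $T_n\in O_n$. TWO wins the play if $\{T_n:n\in\omega\}\in\mathcal{B}$; otherwise ONE wins. A strategy of a player prescribes that player's next move as a function of the opponent's moves so far; it is winning if every play in which the player follows it is won by that player. *)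

theory Defs
  imports "HOL-Analysis.T1_Spaces"
begin

unbundle cardinal_syntax

definition weakly_Lindelof :: "'a topology \<Rightarrow> bool" where
  "weakly_Lindelof X \<longleftrightarrow>
     (\<forall>\<U>. (\<forall>U\<in>\<U>. openin X U) \<and> \<Union>\<U> = topspace X \<longrightarrow>
        (\<exists>\<V>\<subseteq>\<U>. countable \<V> \<and> X closure_of \<Union>\<V> = topspace X))"

text \<open>
  Forcing over the universe of HOL as ground model. The conditions are the elements of the set
  \<open>P\<close>, \<open>one\<close> is the largest one, and \<open>p \<preceq> q\<close> means that \<open>p\<close> is stronger than \<open>q\<close>.
  A sentence of the forcing language is represented by the predicate "\<open>p\<close> forces the sentence".

  Names are typed, according to the level in the type hierarchy of the object they denote:
  \<^item> an element \<open>a\<close> of a ground model type stands for its check name;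
  \<^item> a pair of names stands for the canonical name of the ordered pair of the denoted objects;
  \<^item> a P-name for a set of objects whose names have type \<open>'n\<close> is a set of pairs
    (name of an element, condition), that is, a term of type \<open>('n \<times> 'p) set\<close>.

  Let \<open>A\<close> be a set in the extension all of whose elements have names of type \<open>'n\<close>. Then every
  subset \<open>x\<close> of \<open>A\<close> in the extension has a name of type \<open>('n \<times> 'p) set\<close>: if \<open>y\<close> is any P-name
  of \<open>x\<close>, take the set of all \<open>(z, p)\<close> with \<open>z\<close> of type \<open>'n\<close> and \<open>p\<close> forcing that \<open>z\<close> is in
  \<open>y\<close>. So a quantifier over all names of a type is a quantifier over all objects of the
  corresponding level of the extension. Functions and sequences are sets of ordered pairs.
\<close>

type_synonym ('n, 'p) nset = "('n \<times> 'p) set"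

locale forcing_notion =
  fixes P :: "'p set" and le :: "'p \<Rightarrow> 'p \<Rightarrow> bool"  (infix "\<preceq>" 50) and one :: 'p
  assumes one_in: "one \<in> P"
    and one_top: "p \<in> P \<Longrightarrow> p \<preceq> one"
    and le_refl: "p \<in> P \<Longrightarrow> p \<preceq> p"
    and le_trans: "p \<in> P \<Longrightarrow> q \<in> P \<Longrightarrow> r \<in> P \<Longrightarrow> p \<preceq> q \<Longrightarrow> q \<preceq> r \<Longrightarrow> p \<preceq> r"
begin

text \<open>The logical connectives, by the recursive clauses of the forcing relation. As usual,
  negation, conjunction and universal quantification are primitive and the others are
  defined from them classically.\<close>

definition fNot :: "('p \<Rightarrow> bool) \<Rightarrow> 'p \<Rightarrow> bool"  ("\<^bold>\<not> _" [40] 40) where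
  "(\<^bold>\<not> \<phi>) = (\<lambda>p. \<forall>q\<in>P. q \<preceq> p \<longrightarrow> \<not> \<phi> q)"

definition fAnd :: "('p \<Rightarrow> bool) \<Rightarrow> ('p \<Rightarrow> bool) \<Rightarrow> 'p \<Rightarrow> bool"  (infixr "\<^bold>\<and>" 35) where
  "(\<phi> \<^bold>\<and> \<psi>) = (\<lambda>p. \<phi> p \<and> \<psi> p)"

definition fAll :: "('n \<Rightarrow> 'p \<Rightarrow> bool) \<Rightarrow> 'p \<Rightarrow> bool"  (binder "\<^bold>\<forall>" 10) where
  "(\<^bold>\<forall>x. \<phi> x) = (\<lambda>p. \<forall>x. \<phi> x p)"

definition fImp :: "('p \<Rightarrow> bool) \<Rightarrow> ('p \<Rightarrow> bool) \<Rightarrow> 'p \<Rightarrow> bool"  (infixr "\<^bold>\<longrightarrow>" 25) where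
  "(\<phi> \<^bold>\<longrightarrow> \<psi>) = (\<^bold>\<not> (\<phi> \<^bold>\<and> (\<^bold>\<not> \<psi>)))"

definition fIff :: "('p \<Rightarrow> bool) \<Rightarrow> ('p \<Rightarrow> bool) \<Rightarrow> 'p \<Rightarrow> bool"  (infixr "\<^bold>\<longleftrightarrow>" 25) where
  "(\<phi> \<^bold>\<longleftrightarrow> \<psi>) = ((\<phi> \<^bold>\<longrightarrow> \<psi>) \<^bold>\<and> (\<psi> \<^bold>\<longrightarrow> \<phi>))"

definition fEx :: "('n \<Rightarrow> 'p \<Rightarrow> bool) \<Rightarrow> 'p \<Rightarrow> bool"  (binder "\<^bold>\<exists>" 10) where
  "(\<^bold>\<exists>x. \<phi> x) = (\<^bold>\<not> (\<^bold>\<forall>x. \<^bold>\<not> \<phi> x))"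

text \<open>An atomic statement about check names: it is forced iff it is true in the ground model.\<close>

definition ground :: "bool \<Rightarrow> 'p \<Rightarrow> bool" where
  "ground b = (\<lambda>p. b)"

text \<open>Forced membership: the set of conditions \<open>q\<close> for which there is \<open>(y, r)\<close> in the name with
  \<open>q \<preceq> r\<close> and \<open>q\<close> forcing \<open>x = y\<close> is dense below \<open>p\<close>. The parameter \<open>eq\<close> is forced equality
  for names of elements; pairs whose second component is not a condition are ignored.\<close>

definition fMem :: "('n \<Rightarrow> 'n \<Rightarrow> 'p \<Rightarrow> bool) \<Rightarrow> 'n \<Rightarrow> ('n, 'p) nset \<Rightarrow> 'p \<Rightarrow> bool" where
  "fMem eq x \<sigma> = (\<lambda>p. \<forall>q\<in>P. q \<preceq> p \<longrightarrow>
     (\<exists>q'\<in>P. q' \<preceq> q \<and> (\<exists>(y, r)\<in>\<sigma>. r \<in> P \<and> q' \<preceq> r \<and> eq x y q')))"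

definition eq_ground :: "'g \<Rightarrow> 'g \<Rightarrow> 'p \<Rightarrow> bool" where
  "eq_ground x y = ground (x = y)"

definition eq_pair ::
  "('m \<Rightarrow> 'm \<Rightarrow> 'p \<Rightarrow> bool) \<Rightarrow> ('n \<Rightarrow> 'n \<Rightarrow> 'p \<Rightarrow> bool) \<Rightarrow> 'm \<times> 'n \<Rightarrow> 'm \<times> 'n \<Rightarrow> 'p \<Rightarrow> bool" where
  "eq_pair eq1 eq2 x y = (eq1 (fst x) (fst y) \<^bold>\<and> eq2 (snd x) (snd y))"

definition eq_set ::
  "('n \<Rightarrow> 'n \<Rightarrow> 'p \<Rightarrow> bool) \<Rightarrow> ('n, 'p) nset \<Rightarrow> ('n, 'p) nset \<Rightarrow> 'p \<Rightarrow> bool" where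
  "eq_set eq \<sigma> \<tau> = (\<^bold>\<forall>x. fMem eq x \<sigma> \<^bold>\<longleftrightarrow> fMem eq x \<tau>)"

text \<open>\<open>f\<close> is a function with domain \<open>{x. A x}\<close> and all values in \<open>{y. B y}\<close>.\<close>

definition is_function ::
  "('m \<Rightarrow> 'm \<Rightarrow> 'p \<Rightarrow> bool) \<Rightarrow> ('n \<Rightarrow> 'n \<Rightarrow> 'p \<Rightarrow> bool) \<Rightarrow>
   ('m \<Rightarrow> 'p \<Rightarrow> bool) \<Rightarrow> ('n \<Rightarrow> 'p \<Rightarrow> bool) \<Rightarrow> ('m \<times> 'n, 'p) nset \<Rightarrow> 'p \<Rightarrow> bool" where
  "is_function eq1 eq2 A B f =
     ((\<^bold>\<forall>x. \<^bold>\<forall>y. fMem (eq_pair eq1 eq2) (x, y) f \<^bold>\<longrightarrow> A x \<^bold>\<and> B y) \<^bold>\<and>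
      (\<^bold>\<forall>x. A x \<^bold>\<longrightarrow> (\<^bold>\<exists>y. fMem (eq_pair eq1 eq2) (x, y) f)) \<^bold>\<and>
      (\<^bold>\<forall>x. \<^bold>\<forall>y. \<^bold>\<forall>y'. fMem (eq_pair eq1 eq2) (x, y) f \<^bold>\<and> fMem (eq_pair eq1 eq2) (x, y') f
          \<^bold>\<longrightarrow> eq2 y y'))"

text \<open>Specializations to the objects of the game on a space with points in \<open>'a\<close>: sets of points
  (type \<open>('a, 'p) nset\<close>), families of sets of points, and finite or infinite sequences of sets of
  points, which are functions from a subset of \<open>nat\<close>.\<close>

definition eq_sub :: "('a, 'p) nset \<Rightarrow> ('a, 'p) nset \<Rightarrow> 'p \<Rightarrow> bool" where
  "eq_sub = eq_set eq_ground"

definition eq_fam :: "(('a, 'p) nset, 'p) nset \<Rightarrow> (('a, 'p) nset, 'p) nset \<Rightarrow> 'p \<Rightarrow> bool" where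
  "eq_fam = eq_set eq_sub"

definition eq_seq ::
  "(nat \<times> ('a, 'p) nset, 'p) nset \<Rightarrow> (nat \<times> ('a, 'p) nset, 'p) nset \<Rightarrow> 'p \<Rightarrow> bool" where
  "eq_seq = eq_set (eq_pair eq_ground eq_sub)"

definition in_sub :: "'a \<Rightarrow> ('a, 'p) nset \<Rightarrow> 'p \<Rightarrow> bool" where
  "in_sub = fMem eq_ground"

definition in_fam :: "('a, 'p) nset \<Rightarrow> (('a, 'p) nset, 'p) nset \<Rightarrow> 'p \<Rightarrow> bool" where
  "in_fam = fMem eq_sub"

text \<open>The \<open>i\<close>-th term of the sequence \<open>s\<close> is \<open>U\<close>.\<close>

definition term_at :: "nat \<Rightarrow> ('a, 'p) nset \<Rightarrow> (nat \<times> ('a, 'p) nset, 'p) nset \<Rightarrow> 'p \<Rightarrow> bool" where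
  "term_at i U s = fMem (eq_pair eq_ground eq_sub) (i, U) s"

text \<open>The ground model topology is a base of the topology of the extension: \<open>U\<close> is open iff it is
  the union of a family \<open>S\<close>, in the extension, of ground model open sets.\<close>

definition is_open :: "'a topology \<Rightarrow> ('a, 'p) nset \<Rightarrow> 'p \<Rightarrow> bool" where
  "is_open X U =
     (\<^bold>\<exists>S :: ('a set, 'p) nset.
        (\<^bold>\<forall>B. fMem eq_ground B S \<^bold>\<longrightarrow> ground (openin X B)) \<^bold>\<and>
        (\<^bold>\<forall>x. in_sub x U \<^bold>\<longleftrightarrow> (\<^bold>\<exists>B. fMem eq_ground B S \<^bold>\<and> ground (x \<in> B))))"

definition open_cover :: "'a topology \<Rightarrow> (('a, 'p) nset, 'p) nset \<Rightarrow> 'p \<Rightarrow> bool" where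
  "open_cover X C =
     ((\<^bold>\<forall>U. in_fam U C \<^bold>\<longrightarrow> is_open X U) \<^bold>\<and>
      (\<^bold>\<forall>x. ground (x \<in> topspace X) \<^bold>\<longrightarrow> (\<^bold>\<exists>U. in_fam U C \<^bold>\<and> in_sub x U)))"

text \<open>A family of open sets whose union meets every nonempty open set.\<close>

definition dense_family :: "'a topology \<Rightarrow> (('a, 'p) nset, 'p) nset \<Rightarrow> 'p \<Rightarrow> bool" where
  "dense_family X D =
     ((\<^bold>\<forall>U. in_fam U D \<^bold>\<longrightarrow> is_open X U) \<^bold>\<and>
      (\<^bold>\<forall>W. is_open X W \<^bold>\<and> (\<^bold>\<exists>x. in_sub x W) \<^bold>\<longrightarrow>
         (\<^bold>\<exists>U. in_fam U D \<^bold>\<and> (\<^bold>\<exists>x. in_sub x U \<^bold>\<and> in_sub x W))))"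

definition finite_open_seq :: "'a topology \<Rightarrow> (nat \<times> ('a, 'p) nset, 'p) nset \<Rightarrow> 'p \<Rightarrow> bool" where
  "finite_open_seq X s =
     (\<^bold>\<exists>n. is_function eq_ground eq_sub (\<lambda>i. ground (i < n)) (is_open X) s)"

definition infinite_open_seq :: "'a topology \<Rightarrow> (nat \<times> ('a, 'p) nset, 'p) nset \<Rightarrow> 'p \<Rightarrow> bool" where
  "infinite_open_seq X T =
     is_function eq_ground eq_sub (\<lambda>i. ground (i \<in> (UNIV :: nat set))) (is_open X) T"

text \<open>\<open>s\<close> is the sequence of the first \<open>n\<close> terms of \<open>T\<close>.\<close>

definition initial_segment ::
  "(nat \<times> ('a, 'p) nset, 'p) nset \<Rightarrow> nat \<Rightarrow> (nat \<times> ('a, 'p) nset, 'p) nset \<Rightarrow> 'p \<Rightarrow> bool" where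
  "initial_segment s n T =
     (\<^bold>\<forall>i. \<^bold>\<forall>U. term_at i U s \<^bold>\<longleftrightarrow> ground (i < n) \<^bold>\<and> term_at i U T)"

text \<open>A strategy of ONE assigns an open cover to each finite sequence of open sets, the moves TWO
  has made so far.\<close>

type_synonym ('a, 'q) strategy_name =
  "((nat \<times> ('a, 'q) nset, 'q) nset \<times> (('a, 'q) nset, 'q) nset, 'q) nset"

definition strategy_ONE :: "'a topology \<Rightarrow> ('a, 'p) strategy_name \<Rightarrow> 'p \<Rightarrow> bool" where
  "strategy_ONE X F = is_function eq_seq eq_fam (finite_open_seq X) (open_cover X) F"

text \<open>\<open>T\<close> is the sequence of moves of TWO in a play in which ONE follows \<open>F\<close>: in each inning \<open>n\<close>
  ONE selects \<open>C\<close>, the value of \<open>F\<close> at the first \<open>n\<close> moves of TWO, and TWO responds with an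
  element of \<open>C\<close>.\<close>

definition play_following ::
  "'a topology \<Rightarrow> ('a, 'p) strategy_name \<Rightarrow> (nat \<times> ('a, 'p) nset, 'p) nset \<Rightarrow> 'p \<Rightarrow> bool" where
  "play_following X F T =
     (infinite_open_seq X T \<^bold>\<and>
      (\<^bold>\<forall>n. \<^bold>\<exists>s. \<^bold>\<exists>C. \<^bold>\<exists>U. initial_segment s n T \<^bold>\<and> fMem (eq_pair eq_seq eq_fam) (s, C) F \<^bold>\<and>
         term_at n U T \<^bold>\<and> in_fam U C))"

definition TWO_wins :: "'a topology \<Rightarrow> (nat \<times> ('a, 'p) nset, 'p) nset \<Rightarrow> 'p \<Rightarrow> bool" where
  "TWO_wins X T =
     (\<^bold>\<exists>D. (\<^bold>\<forall>U. in_fam U D \<^bold>\<longleftrightarrow> (\<^bold>\<exists>n. term_at n U T)) \<^bold>\<and> dense_family X D)"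

definition winning_strategy_ONE :: "'a topology \<Rightarrow> ('a, 'p) strategy_name \<Rightarrow> 'p \<Rightarrow> bool" where
  "winning_strategy_ONE X F =
     (strategy_ONE X F \<^bold>\<and> (\<^bold>\<forall>T. play_following X F T \<^bold>\<longrightarrow> (\<^bold>\<not> TWO_wins X T)))"

definition no_winning_strategy_ONE :: "'a topology \<Rightarrow> 'p \<Rightarrow> bool" where
  "no_winning_strategy_ONE X = (\<^bold>\<not> (\<^bold>\<exists>F. winning_strategy_ONE X F))"

definition holds_in_extension :: "('p \<Rightarrow> bool) \<Rightarrow> bool" where
  "holds_in_extension \<phi> \<longleftrightarrow> \<phi> one"

end

text \<open>The poset for adding \<open>\<kappa>\<close> Cohen reals, for a cardinal \<open>\<kappa>\<close>, which is a well-order on the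
  set \<open>Field \<kappa>\<close>. The largest condition is the empty function.\<close>

definition cohen :: "'k rel \<Rightarrow> ('k \<times> nat \<rightharpoonup> nat) set" where
  "cohen \<kappa> = {p. finite (dom p) \<and> dom p \<subseteq> Field \<kappa> \<times> UNIV}"

definition cohen_le :: "('k \<times> nat \<rightharpoonup> nat) \<Rightarrow> ('k \<times> nat \<rightharpoonup> nat) \<Rightarrow> bool" where
  "cohen_le p q \<longleftrightarrow> q \<subseteq>\<^sub>m p"

lemma forcing_notion_cohen: "forcing_notion (cohen \<kappa>) cohen_le Map.empty"
  by unfold_locales (auto simp: cohen_def cohen_le_def intro: map_le_trans)

end

theory Submission
  imports Defs "HOL-Library.Countable_Set_Type"
begin

text \<open>
  Let \<open>p\<close> force that \<open>F\<close> is a strategy of ONE. The proof finds a play against \<open>F\<close> that TWO wins, by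
  letting one of the Cohen reals choose the moves of TWO.

  Consider a position, that is, a finite list of names of moves of TWO, and a condition \<open>q\<close> below
  \<open>p\<close>. The answer of \<open>F\<close> is an open cover, so each point of \<open>X\<close> has a ground model open
  neighbourhood \<open>B\<close> such that some \<open>r\<close> below \<open>q\<close> forces \<open>B\<close> to be contained in a legal reply
  of TWO. These sets \<open>B\<close> form an open cover in the ground model. Weak Lindelofness, applied there,
  yields countably many of them, \<open>B n\<close>, with dense union, together with conditions \<open>r n\<close> and names
  \<open>U n\<close> of replies (\<open>dense_legal_replies\<close>). By the maximal principle, \<open>U n\<close> can be
  chosen such that \<open>p\<close> itself forces it to be a legal reply, while \<open>r n\<close> forces it to contain
  \<open>B n\<close>. Hence the pairs \<open>(q, n)\<close> label the edges of a tree of legal moves.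

  All conditions have finite support. A closing-off argument (\<open>countable_closure\<close>) gives a
  countable set \<open>A\<close> of coordinates such that, for positions and conditions \<open>q\<close> that come from
  conditions supported by \<open>A\<close>, all \<open>r n\<close> are supported by \<open>A\<close> as well. Only countably many
  labels \<open>(q, n)\<close> remain, so they can be coded by natural numbers, and the Cohen real at a coordinate
  \<open>\<alpha>\<close> outside of \<open>A\<close> picks a branch through the tree. This is where \<open>\<kappa>\<close> is uncountable.

  The branch is a play that follows \<open>F\<close>, and TWO wins it by genericity. Let \<open>q\<close> be a condition below
  \<open>p\<close> and \<open>W\<close> a nonempty open set. Extend \<open>q\<close> to \<open>r\<close> that decides exactly the first \<open>m\<close> values of
  the real at \<open>\<alpha>\<close>, hence a position of the tree, and let \<open>q0\<close> be the restriction of \<open>r\<close> to \<open>A\<close>.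
  Some \<open>B n\<close> obtained for this position and \<open>q0\<close> meets \<open>W\<close>. The corresponding \<open>r n\<close> extends \<open>q0\<close>
  and is supported by \<open>A\<close>, so it is compatible with \<open>r\<close> and says nothing about \<open>\<alpha>\<close>. Thus one can
  still let the next value of the real be the code of \<open>(q0, n)\<close>, and then the move \<open>m\<close> of
  TWO contains \<open>B n\<close>.
\<close>

section \<open>Calculating with the forcing relation\<close>

context forcing_notion
begin

text \<open>The predicates that behave like sentences of the forcing language: what holds at a condition
  holds at all stronger ones, and what holds densely below a condition holds at it. In other words,
  the set of conditions is regular open.\<close>

definition regular :: "('p \<Rightarrow> bool) \<Rightarrow> bool" where
  "regular \<phi> \<longleftrightarrow> (\<forall>p\<in>P. \<forall>q\<in>P. q \<preceq> p \<longrightarrow> \<phi> p \<longrightarrow> \<phi> q) \<and>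
     (\<forall>p\<in>P. (\<forall>q\<in>P. q \<preceq> p \<longrightarrow> (\<exists>r\<in>P. r \<preceq> q \<and> \<phi> r)) \<longrightarrow> \<phi> p)"

lemma regular_mono: "regular \<phi> \<Longrightarrow> \<phi> p \<Longrightarrow> p \<in> P \<Longrightarrow> q \<in> P \<Longrightarrow> q \<preceq> p \<Longrightarrow> \<phi> q"
  unfolding regular_def by blast

lemma regular_dense:
  assumes "regular \<phi>" "p \<in> P" "\<And>q. q \<in> P \<Longrightarrow> q \<preceq> p \<Longrightarrow> \<exists>r\<in>P. r \<preceq> q \<and> \<phi> r"
  shows "\<phi> p"
  using assms unfolding regular_def by blast

lemma regularI:
  assumes "\<And>p q. p \<in> P \<Longrightarrow> q \<in> P \<Longrightarrow> q \<preceq> p \<Longrightarrow> \<phi> p \<Longrightarrow> \<phi> q"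
    and "\<And>p. p \<in> P \<Longrightarrow> (\<And>q. q \<in> P \<Longrightarrow> q \<preceq> p \<Longrightarrow> \<exists>r\<in>P. r \<preceq> q \<and> \<phi> r) \<Longrightarrow> \<phi> p"
  shows "regular \<phi>"
  using assms unfolding regular_def by blast

lemma fAnd_iff: "(\<phi> \<^bold>\<and> \<psi>) p \<longleftrightarrow> \<phi> p \<and> \<psi> p"
  by (simp add: fAnd_def)

lemma fAll_iff: "(\<^bold>\<forall>x. \<phi> x) p \<longleftrightarrow> (\<forall>x. \<phi> x p)"
  by (simp add: fAll_def)

lemma ground_iff: "ground b p \<longleftrightarrow> b"
  by (simp add: ground_def)

lemma regular_ground: "regular (ground b)"
  unfolding regular_def ground_def using le_refl by blast

lemma regular_fNot: "regular \<phi> \<Longrightarrow> regular (\<^bold>\<not> \<phi>)"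
  unfolding regular_def fNot_def by (meson le_trans le_refl)

lemma regular_fAnd: "regular \<phi> \<Longrightarrow> regular \<psi> \<Longrightarrow> regular (\<phi> \<^bold>\<and> \<psi>)"
  unfolding fAnd_def
  by (rule regularI) (blast intro: regular_mono, blast intro: regular_dense)

lemma regular_fAll: "(\<And>x. regular (\<phi> x)) \<Longrightarrow> regular (\<^bold>\<forall>x. \<phi> x)"
  unfolding fAll_def
  by (rule regularI) (blast intro: regular_mono, blast intro: regular_dense)

lemma regular_fImp: "regular \<phi> \<Longrightarrow> regular \<psi> \<Longrightarrow> regular (\<phi> \<^bold>\<longrightarrow> \<psi>)"
  unfolding fImp_def by (intro regular_fNot regular_fAnd)

lemma regular_fIff: "regular \<phi> \<Longrightarrow> regular \<psi> \<Longrightarrow> regular (\<phi> \<^bold>\<longleftrightarrow> \<psi>)"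
  unfolding fIff_def by (intro regular_fImp regular_fAnd)

lemma regular_fEx: "(\<And>x. regular (\<phi> x)) \<Longrightarrow> regular (\<^bold>\<exists>x. \<phi> x)"
  unfolding fEx_def by (intro regular_fNot regular_fAll)

lemma regular_fMem: "regular (fMem eq x \<sigma>)"
proof (rule regularI)
  fix p q assume "p \<in> P" "q \<in> P" "q \<preceq> p" "fMem eq x \<sigma> p"
  then show "fMem eq x \<sigma> q"
    unfolding fMem_def using le_trans by meson
next
  fix p assume p: "p \<in> P" and d: "\<And>q. q \<in> P \<Longrightarrow> q \<preceq> p \<Longrightarrow> \<exists>r\<in>P. r \<preceq> q \<and> fMem eq x \<sigma> r"
  show "fMem eq x \<sigma> p"
    unfolding fMem_def
  proof (intro ballI impI)
    fix q assume q: "q \<in> P" "q \<preceq> p"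
    then obtain r where r: "r \<in> P" "r \<preceq> q" "fMem eq x \<sigma> r" using d by blast
    then obtain q' where "q' \<in> P" "q' \<preceq> r" "\<exists>(y, s)\<in>\<sigma>. s \<in> P \<and> q' \<preceq> s \<and> eq x y q'"
      unfolding fMem_def using le_refl by blast
    then show "\<exists>q'\<in>P. q' \<preceq> q \<and> (\<exists>(y, s)\<in>\<sigma>. s \<in> P \<and> q' \<preceq> s \<and> eq x y q')"
      using q r le_trans by blast
  qed
qed

lemma regular_eq_set: "regular (eq_set eq \<sigma> \<tau>)"
  unfolding eq_set_def by (intro regular_fAll regular_fIff regular_fMem)

lemma regular_eq_sub: "regular (eq_sub U V)"
  unfolding eq_sub_def by (rule regular_eq_set)

lemma regular_in_sub: "regular (in_sub x U)"
  unfolding in_sub_def by (rule regular_fMem)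

lemma regular_in_fam: "regular (in_fam U C)"
  unfolding in_fam_def by (rule regular_fMem)

lemma regular_term_at: "regular (term_at i U s)"
  unfolding term_at_def by (rule regular_fMem)

lemmas regular_intros =
  regular_ground regular_fNot regular_fAnd regular_fAll regular_fImp regular_fIff regular_fEx
  regular_fMem regular_eq_sub regular_in_sub regular_in_fam regular_term_at

lemma regular_is_open: "regular (is_open X U)"
  unfolding is_open_def by (intro regular_intros)

lemma regular_open_cover: "regular (open_cover X C)"
  unfolding open_cover_def by (intro regular_intros regular_is_open)

lemma regular_finite_open_seq: "regular (finite_open_seq X s)"
  unfolding finite_open_seq_def is_function_def by (intro regular_intros regular_is_open)

lemma fImpI:
  assumes "p \<in> P" "\<And>q. q \<in> P \<Longrightarrow> q \<preceq> p \<Longrightarrow> \<phi> q \<Longrightarrow> \<psi> q"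
  shows "(\<phi> \<^bold>\<longrightarrow> \<psi>) p"
  unfolding fImp_def fNot_def fAnd_def using assms le_refl by blast

lemma fImpD:
  assumes "(\<phi> \<^bold>\<longrightarrow> \<psi>) p" "p \<in> P" "q \<in> P" "q \<preceq> p" "\<phi> q" "regular \<phi>" "regular \<psi>"
  shows "\<psi> q"
proof (rule regular_dense[OF \<open>regular \<psi>\<close> \<open>q \<in> P\<close>])
  fix r assume r: "r \<in> P" "r \<preceq> q"
  then have "\<phi> r" using assms regular_mono by blast
  moreover have "r \<preceq> p" using r assms le_trans by blast
  ultimately show "\<exists>s\<in>P. s \<preceq> r \<and> \<psi> s"
    using assms(1) r unfolding fImp_def fNot_def fAnd_def by blast
qed

lemma fIff_iff:
  assumes "p \<in> P" "regular \<phi>" "regular \<psi>"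
  shows "(\<phi> \<^bold>\<longleftrightarrow> \<psi>) p \<longleftrightarrow> (\<forall>q\<in>P. q \<preceq> p \<longrightarrow> \<phi> q = \<psi> q)"
proof
  assume a: "(\<phi> \<^bold>\<longleftrightarrow> \<psi>) p"
  then have "(\<phi> \<^bold>\<longrightarrow> \<psi>) p" "(\<psi> \<^bold>\<longrightarrow> \<phi>) p" by (auto simp: fIff_def fAnd_def)
  then show "\<forall>q\<in>P. q \<preceq> p \<longrightarrow> \<phi> q = \<psi> q" using fImpD assms by metis
next
  assume "\<forall>q\<in>P. q \<preceq> p \<longrightarrow> \<phi> q = \<psi> q"
  then show "(\<phi> \<^bold>\<longleftrightarrow> \<psi>) p"
    unfolding fIff_def fAnd_def using fImpI assms(1) by metis
qed

lemma fEx_iff: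
  "(\<^bold>\<exists>x. \<phi> x) p \<longleftrightarrow> (\<forall>q\<in>P. q \<preceq> p \<longrightarrow> (\<exists>r\<in>P. r \<preceq> q \<and> (\<exists>x. \<phi> x r)))"
  unfolding fEx_def fNot_def fAll_def by blast

lemma fExD:
  assumes "(\<^bold>\<exists>x. \<phi> x) p" "p \<in> P"
  obtains r x where "r \<in> P" "r \<preceq> p" "\<phi> x r"
  using assms le_refl unfolding fEx_iff by blast

lemma fExI:
  assumes "\<phi> x p" "p \<in> P" "regular (\<phi> x)"
  shows "(\<^bold>\<exists>x. \<phi> x) p"
  using assms le_refl unfolding fEx_iff by (meson regular_mono)

lemma eq_set_iff:
  "p \<in> P \<Longrightarrow> eq_set eq \<sigma> \<tau> p \<longleftrightarrow> (\<forall>x. \<forall>q\<in>P. q \<preceq> p \<longrightarrow> fMem eq x \<sigma> q = fMem eq x \<tau> q)"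
  unfolding eq_set_def fAll_def by (simp add: fIff_iff regular_fMem)

lemma eq_sub_iff:
  "p \<in> P \<Longrightarrow> eq_sub U V p \<longleftrightarrow> (\<forall>x. \<forall>q\<in>P. q \<preceq> p \<longrightarrow> in_sub x U q = in_sub x V q)"
  unfolding eq_sub_def in_sub_def by (rule eq_set_iff)

lemma eq_sub_refl: "p \<in> P \<Longrightarrow> eq_sub U U p"
  by (simp add: eq_sub_iff)

lemma eq_sub_sym: "p \<in> P \<Longrightarrow> eq_sub U V p \<Longrightarrow> eq_sub V U p"
  by (simp add: eq_sub_iff)

lemma eq_sub_trans: "p \<in> P \<Longrightarrow> eq_sub U V p \<Longrightarrow> eq_sub V W p \<Longrightarrow> eq_sub U W p"
  by (simp add: eq_sub_iff)

lemma eq_sub_mono: "eq_sub U V p \<Longrightarrow> p \<in> P \<Longrightarrow> q \<in> P \<Longrightarrow> q \<preceq> p \<Longrightarrow> eq_sub U V q"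
  using regular_mono[OF regular_eq_sub] .

lemma in_fam_cong:
  assumes "in_fam U C p" "eq_sub U V p" "p \<in> P"
  shows "in_fam V C p"
  unfolding in_fam_def fMem_def
proof (intro ballI impI)
  fix q assume q: "q \<in> P" "q \<preceq> p"
  then obtain q' y r where q': "q' \<in> P" "q' \<preceq> q" "(y, r) \<in> C" "r \<in> P" "q' \<preceq> r" "eq_sub U y q'"
    using assms(1) unfolding in_fam_def fMem_def by blast
  have "q' \<preceq> p" using q q' assms le_trans by blast
  then have "eq_sub V y q'"
    using q' assms eq_sub_mono eq_sub_sym eq_sub_trans by metis
  then show "\<exists>q'\<in>P. q' \<preceq> q \<and> (\<exists>(y, r)\<in>C. r \<in> P \<and> q' \<preceq> r \<and> eq_sub V y q')"
    using q' by blast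
qed

text \<open>The matrix of the definition of \<open>is_open\<close>, kept as one predicate so that openness becomes
  a purely existential statement about names \<open>S\<close> of families of ground model open sets.\<close>

definition forced_union :: "'a topology \<Rightarrow> ('a set, 'p) nset \<Rightarrow> ('a, 'p) nset \<Rightarrow> 'p \<Rightarrow> bool" where
  "forced_union X S U p \<longleftrightarrow> (\<forall>B. (fMem eq_ground B S \<^bold>\<longrightarrow> ground (openin X B)) p) \<and>
     (\<forall>x. \<forall>q\<in>P. q \<preceq> p \<longrightarrow> in_sub x U q = (\<^bold>\<exists>B. fMem eq_ground B S \<^bold>\<and> ground (x \<in> B)) q)"

lemma is_open_iff:
  "is_open X U p \<longleftrightarrow> (\<forall>q\<in>P. q \<preceq> p \<longrightarrow> (\<exists>r\<in>P. r \<preceq> q \<and> (\<exists>S. forced_union X S U r)))"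
proof -
  have reg: "regular (\<^bold>\<exists>B. fMem eq_ground B S \<^bold>\<and> ground (x \<in> B))" for x and S :: "('a set, 'p) nset"
    by (intro regular_intros)
  have "((\<^bold>\<forall>B. fMem eq_ground B S \<^bold>\<longrightarrow> ground (openin X B)) \<^bold>\<and>
      (\<^bold>\<forall>x. in_sub x U \<^bold>\<longleftrightarrow> (\<^bold>\<exists>B. fMem eq_ground B S \<^bold>\<and> ground (x \<in> B)))) r \<longleftrightarrow>
      forced_union X S U r" if "r \<in> P" for r S
    unfolding forced_union_def fAnd_iff[of "fAll _" "fAll _"] fAll_iff
      fIff_iff[OF that regular_in_sub reg] ..
  then show ?thesis
    unfolding is_open_def fEx_iff[where p = p] by (simp cong: bex_cong)
qed

lemma is_open_cong:
  assumes "is_open X U p" "eq_sub U V p" "p \<in> P"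
  shows "is_open X V p"
  unfolding is_open_iff
proof (intro ballI impI)
  fix q assume q: "q \<in> P" "q \<preceq> p"
  then obtain r S where r: "r \<in> P" "r \<preceq> q" "forced_union X S U r"
    using assms(1) unfolding is_open_iff by blast
  have "in_sub x V s = in_sub x U s" if "s \<in> P" "s \<preceq> r" for x s
    using assms(2) that q r le_trans \<open>p \<in> P\<close> unfolding eq_sub_iff[OF \<open>p \<in> P\<close>] by metis
  then have "forced_union X S V r"
    using r(3) unfolding forced_union_def by simp
  then show "\<exists>r\<in>P. r \<preceq> q \<and> (\<exists>S. forced_union X S V r)"
    using r by blast
qed

text \<open>In a generic extension, a point of an open set has a ground model neighbourhood inside it; a
  stronger condition decides which.\<close>

lemma is_open_basic:
  assumes "is_open X U p" "in_sub x U p" "p \<in> P"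
  obtains r B where "r \<in> P" "r \<preceq> p" "openin X B" "x \<in> B" "\<And>y. y \<in> B \<Longrightarrow> in_sub y U r"
proof -
  obtain r S where r: "r \<in> P" "r \<preceq> p" and fu: "forced_union X S U r"
    using assms(1,3) le_refl unfolding is_open_iff by blast
  have S: "\<And>B. (fMem eq_ground B S \<^bold>\<longrightarrow> ground (openin X B)) r"
      "\<And>x s. s \<in> P \<Longrightarrow> s \<preceq> r \<Longrightarrow> in_sub x U s = (\<^bold>\<exists>B. fMem eq_ground B S \<^bold>\<and> ground (x \<in> B)) s"
    using fu unfolding forced_union_def by simp_all
  have "in_sub x U r" using regular_mono[OF regular_in_sub assms(2,3) r] .
  then have "(\<^bold>\<exists>B. fMem eq_ground B S \<^bold>\<and> ground (x \<in> B)) r"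
    using S(2)[OF r(1) le_refl[OF r(1)]] by simp
  then obtain s B where s: "s \<in> P" "s \<preceq> r" "fMem eq_ground B S s" "x \<in> B"
    using r(1) by (elim fExD) (auto simp: fAnd_iff ground_iff)
  have "ground (openin X B) s"
    by (rule fImpD[OF S(1) r(1) s(1,2,3) regular_fMem regular_ground])
  moreover have "in_sub y U s" if "y \<in> B" for y
    unfolding S(2)[OF s(1,2)]
    by (rule fExI[where x = B])
      (use s that in \<open>auto simp: fAnd_iff ground_iff intro!: regular_intros\<close>)
  moreover have "s \<preceq> p" using le_trans[OF s(1) r(1) assms(3) s(2) r(2)] .
  ultimately show thesis using that[of s B] s unfolding ground_iff by simp
qed

text \<open>The maximal principle for names of sets of points: a name is glued together from names
  \<open>W i\<close> that work at the conditions \<open>i\<close> of a dense set. Instead of a maximal antichain, a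
  well-order of the conditions decides which \<open>W i\<close> is used: the first \<open>i\<close> in the generic filter.\<close>

lemma maximal_principle:
  fixes \<phi> :: "('a, 'p) nset \<Rightarrow> 'p \<Rightarrow> bool"
  assumes p: "p \<in> P" and reg: "\<And>U. regular (\<phi> U)"
    and cong: "\<And>U V q. q \<in> P \<Longrightarrow> \<phi> U q \<Longrightarrow> eq_sub U V q \<Longrightarrow> \<phi> V q"
    and ex: "\<And>q. q \<in> P \<Longrightarrow> q \<preceq> p \<Longrightarrow> \<exists>r\<in>P. r \<preceq> q \<and> (\<exists>U. \<phi> U r)"
  shows "\<exists>U. \<phi> U p"
proof -
  define D where "D = {i\<in>P. \<exists>U. \<phi> U i}"
  have "\<forall>i\<in>D. \<exists>U. \<phi> U i" unfolding D_def by simp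
  then obtain W where "\<forall>i\<in>D. \<phi> (W i) i" by (rule bchoice[THEN exE])
  then have W: "\<And>i. i \<in> D \<Longrightarrow> \<phi> (W i) i" ..
  obtain wo :: "'p rel" where wo: "Well_order wo" "Field wo = UNIV" using well_ordering by (elim exE conjE)
  define ls where "ls = wo - Id"
  have wf: "wf ls"
    using wo(1) unfolding ls_def well_order_on_def by (rule conjunct2)
  have "total_on UNIV wo"
    using wo unfolding well_order_on_def linear_order_on_def by metis
  then have tot: "\<And>i j. i \<noteq> j \<Longrightarrow> (i, j) \<in> ls \<or> (j, i) \<in> ls"
    unfolding ls_def total_on_def by blast
  define first where "first t i \<longleftrightarrow> t \<in> P \<and> i \<in> D \<and> t \<preceq> i \<and>
    (\<forall>j\<in>D. (j, i) \<in> ls \<longrightarrow> \<not> (\<exists>s\<in>P. s \<preceq> t \<and> s \<preceq> j))" for t i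
  define U where "U = {(x, t). \<exists>i. first t i \<and> in_sub x (W i) t}"
  have first_mono: "first s i" if "first t i" "s \<in> P" "s \<preceq> t" for s t i
  proof -
    have t: "t \<in> P" "t \<preceq> i" "i \<in> P" using that(1) unfolding first_def D_def by blast+
    have "s \<preceq> i" using le_trans[OF that(2) t(1,3) that(3) t(2)] .
    moreover have "s' \<preceq> t" if "s' \<in> P" "s' \<preceq> s" for s'
      using le_trans[OF that(1) \<open>s \<in> P\<close> t(1) that(2) \<open>s \<preceq> t\<close>] .
    ultimately show ?thesis using that(1,2) unfolding first_def by blast
  qed
  have first_unique: "i = j" if "first t i" "first t j" for t i j
    using that tot[of i j] le_refl[of t] unfolding first_def by blast
  have eq: "eq_sub (W i) U t" if ti: "first t i" for t i
  proof -
    have "in_sub x (W i) q \<longleftrightarrow> in_sub x U q" if q: "q \<in> P" "q \<preceq> t" for x q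
    proof
      assume a: "in_sub x (W i) q"
      show "in_sub x U q" unfolding in_sub_def fMem_def
      proof (intro ballI impI)
        fix s assume s: "s \<in> P" "s \<preceq> q"
        have "in_sub x (W i) s" using regular_mono[OF regular_in_sub a q(1) s] .
        moreover have "first s i"
          using first_mono[OF first_mono[OF ti q] s] .
        ultimately have "(x, s) \<in> U" unfolding U_def by blast
        then show "\<exists>s'\<in>P. s' \<preceq> s \<and> (\<exists>(y, r)\<in>U. r \<in> P \<and> s' \<preceq> r \<and> eq_ground x y s')"
          using s(1) le_refl[OF s(1)] unfolding eq_ground_def ground_def by blast
      qed
    next
      assume a: "in_sub x U q"
      show "in_sub x (W i) q"
      proof (rule regular_dense[OF regular_in_sub q(1)])
        fix s assume s: "s \<in> P" "s \<preceq> q"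
        then obtain s' r where s': "s' \<in> P" "s' \<preceq> s" "(x, r) \<in> U" "r \<in> P" "s' \<preceq> r"
          using a unfolding in_sub_def fMem_def eq_ground_def ground_def by blast
        then obtain j where j: "first r j" "in_sub x (W j) r" unfolding U_def by blast
        have "first s' i" using first_mono[OF first_mono[OF first_mono[OF ti q] s] s'(1,2)] .
        then have "j = i"
          using first_unique[OF first_mono[OF j(1) s'(1,5)]] by blast
        then show "\<exists>r\<in>P. r \<preceq> s \<and> in_sub x (W i) r"
          using s' regular_mono[OF regular_in_sub j(2) s'(4,1,5)] by blast
      qed
    qed
    moreover have "t \<in> P" using ti unfolding first_def by blast
    ultimately show ?thesis by (simp add: eq_sub_iff)
  qed
  have "\<phi> U p"
  proof (rule regular_dense[OF reg p])
    fix q assume q: "q \<in> P" "q \<preceq> p"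
    \<comment> \<open>The least member of \<open>D\<close> that is compatible with \<open>q\<close> is first below a common extension.\<close>
    let ?K = "{i\<in>D. \<exists>s\<in>P. s \<preceq> q \<and> s \<preceq> i}"
    have "?K \<noteq> {}" using ex[OF q] le_refl unfolding D_def by blast
    then obtain i where i: "i \<in> ?K" and min: "\<And>j. (j, i) \<in> ls \<Longrightarrow> j \<notin> ?K"
      by (rule wfE_min'[OF wf]) blast
    then obtain s where s: "s \<in> P" "s \<preceq> q" "s \<preceq> i" by blast
    have "j \<notin> D" if "(j, i) \<in> ls" "s' \<in> P" "s' \<preceq> s" "s' \<preceq> j" for j s'
      using min[OF that(1)] that(2,4) le_trans[OF that(2) s(1) q(1) that(3) s(2)] by blast
    then have "first s i" unfolding first_def using s i by blast
    moreover have "i \<in> P" using i unfolding D_def by blast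
    then have "\<phi> (W i) s" using regular_mono[OF reg W _ s(1,3)] i by blast
    ultimately have "\<phi> U s" using cong[OF s(1)] eq by blast
    then show "\<exists>r\<in>P. r \<preceq> q \<and> \<phi> U r" using s by blast
  qed
  then show ?thesis by blast
qed

section \<open>Legal replies of TWO to a strategy of ONE\<close>

lemma eq_pair_ground_sub:
  "eq_pair eq_ground eq_sub (i, U) (j, V) q \<longleftrightarrow> i = j \<and> eq_sub U V q"
  by (simp add: eq_pair_def fAnd_def eq_ground_def ground_def)

definition seq_name :: "('a, 'p) nset list \<Rightarrow> (nat \<times> ('a, 'p) nset, 'p) nset" where
  "seq_name L = {((i, L ! i), one) | i. i < length L}"

lemma term_at_seq_name:
  assumes "p \<in> P"
  shows "term_at i U (seq_name L) p \<longleftrightarrow> i < length L \<and> eq_sub U (L ! i) p"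
proof
  assume a: "term_at i U (seq_name L) p"
  have *: "\<exists>r\<in>P. r \<preceq> q \<and> i < length L \<and> eq_sub U (L ! i) r" if "q \<in> P" "q \<preceq> p" for q
    using a that unfolding term_at_def fMem_def seq_name_def
    by (fastforce simp: eq_pair_ground_sub)
  then have "i < length L" using assms le_refl by blast
  then show "i < length L \<and> eq_sub U (L ! i) p"
    using regular_dense[OF regular_eq_sub assms] * by blast
next
  assume "i < length L \<and> eq_sub U (L ! i) p"
  then show "term_at i U (seq_name L) p"
    unfolding term_at_def fMem_def seq_name_def
    using assms one_in one_top le_refl eq_sub_mono
    by (fastforce simp: eq_pair_ground_sub)
qed

lemma finite_open_seq_name:
  assumes p: "p \<in> P" and L: "\<And>U. U \<in> set L \<Longrightarrow> is_open X U p"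
  shows "finite_open_seq X (seq_name L) p"
proof -
  note tm = term_at_seq_name[unfolded term_at_def]
  have "is_function eq_ground eq_sub (\<lambda>i. ground (i < length L)) (is_open X) (seq_name L) p"
    unfolding is_function_def fAnd_def fAll_def
  proof (intro conjI allI)
    fix i U
    show "(fMem (eq_pair eq_ground eq_sub) (i, U) (seq_name L) \<^bold>\<longrightarrow>
        (\<lambda>p. ground (i < length L) p \<and> is_open X U p)) p"
    proof (rule fImpI[OF p])
      fix q assume q: "q \<in> P" "q \<preceq> p" "fMem (eq_pair eq_ground eq_sub) (i, U) (seq_name L) q"
      then have i: "i < length L" "eq_sub U (L ! i) q" using tm by auto
      then have "is_open X (L ! i) q" using regular_mono[OF regular_is_open L[OF nth_mem]] p q by blast
      then show "ground (i < length L) q \<and> is_open X U q"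
        using i q is_open_cong eq_sub_sym unfolding ground_def by blast
    qed
    show "(ground (i < length L) \<^bold>\<longrightarrow>
        (\<^bold>\<exists>U. fMem (eq_pair eq_ground eq_sub) (i, U) (seq_name L))) p"
    proof (rule fImpI[OF p])
      fix q assume q: "q \<in> P" "q \<preceq> p" "ground (i < length L) q"
      then have "fMem (eq_pair eq_ground eq_sub) (i, L ! i) (seq_name L) q"
        using tm eq_sub_refl unfolding ground_def by blast
      then show "(\<^bold>\<exists>U. fMem (eq_pair eq_ground eq_sub) (i, U) (seq_name L)) q"
        by (rule fExI[where x = "L ! i", OF _ q(1) regular_fMem])
    qed
    fix U'
    show "((\<lambda>p. fMem (eq_pair eq_ground eq_sub) (i, U) (seq_name L) p \<and>
         fMem (eq_pair eq_ground eq_sub) (i, U') (seq_name L) p) \<^bold>\<longrightarrow> eq_sub U U') p"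
      by (intro fImpI[OF p]) (simp add: tm, meson eq_sub_sym eq_sub_trans)
  qed
  then show ?thesis
    unfolding finite_open_seq_def
    by (rule fExI[where x = "length L"])
      (use p in \<open>auto simp: is_function_def intro!: regular_intros regular_is_open\<close>)
qed

text \<open>A set of points is a legal reply of TWO at the position \<open>L\<close> if it belongs to the cover that
  \<open>F\<close> selects there. Quantifying over the value \<open>C\<close> inside the forcing language leaves a
  predicate of the single name \<open>U\<close>, to which the maximal principle for sets of points applies.\<close>

definition legal_reply ::
  "('a, 'p) strategy_name \<Rightarrow> ('a, 'p) nset list \<Rightarrow> ('a, 'p) nset \<Rightarrow> 'p \<Rightarrow> bool" where
  "legal_reply F L U = (\<^bold>\<exists>C. fMem (eq_pair eq_seq eq_fam) (seq_name L, C) F \<^bold>\<and> in_fam U C)"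

lemma regular_legal_reply: "regular (legal_reply F L U)"
  unfolding legal_reply_def by (intro regular_intros)

lemma legal_reply_cong:
  assumes "legal_reply F L U p" "eq_sub U V p" "p \<in> P"
  shows "legal_reply F L V p"
  unfolding legal_reply_def fEx_iff
proof (intro ballI impI)
  fix q assume q: "q \<in> P" "q \<preceq> p"
  then obtain r C where r: "r \<in> P" "r \<preceq> q"
    "fMem (eq_pair eq_seq eq_fam) (seq_name L, C) F r" "in_fam U C r"
    using assms(1) unfolding legal_reply_def fEx_iff fAnd_def by blast
  moreover have "eq_sub U V r" using r q assms eq_sub_mono le_trans by meson
  ultimately show "\<exists>r\<in>P. r \<preceq> q \<and>
      (\<exists>C. (fMem (eq_pair eq_seq eq_fam) (seq_name L, C) F \<^bold>\<and> in_fam V C) r)"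
    using in_fam_cong unfolding fAnd_def by blast
qed

lemma strategy_value_open_cover:
  assumes "strategy_ONE X F p" "p \<in> P" "q \<in> P" "q \<preceq> p"
    and "fMem (eq_pair eq_seq eq_fam) (s, C) F q"
  shows "open_cover X C q"
proof -
  have "(fMem (eq_pair eq_seq eq_fam) (s, C) F \<^bold>\<longrightarrow> finite_open_seq X s \<^bold>\<and> open_cover X C) p"
    using assms(1) unfolding strategy_ONE_def is_function_def fAnd_def fAll_def by blast
  then have "(finite_open_seq X s \<^bold>\<and> open_cover X C) q"
    by (rule fImpD) (use assms in \<open>auto intro!: regular_intros regular_finite_open_seq regular_open_cover\<close>)
  then show ?thesis unfolding fAnd_def by blast
qed

lemma open_cover_member_open:
  assumes "open_cover X C p" "in_fam U C p" "p \<in> P"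
  shows "is_open X U p"
  using assms le_refl fImpD[OF _ _ _ _ _ regular_in_fam regular_is_open]
  unfolding open_cover_def fAnd_def fAll_def by blast

lemma legal_reply_open:
  assumes "strategy_ONE X F p" "p \<in> P" "legal_reply F L U p"
  shows "is_open X U p"
proof (rule regular_dense[OF regular_is_open \<open>p \<in> P\<close>])
  fix q assume q: "q \<in> P" "q \<preceq> p"
  then obtain r C where r: "r \<in> P" "r \<preceq> q"
    "fMem (eq_pair eq_seq eq_fam) (seq_name L, C) F r" "in_fam U C r"
    using assms(3) unfolding legal_reply_def fEx_iff fAnd_def by blast
  moreover have "r \<preceq> p" using r q assms le_trans by blast
  ultimately show "\<exists>r\<in>P. r \<preceq> q \<and> is_open X U r"
    using strategy_value_open_cover[OF assms(1,2)] open_cover_member_open by blast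
qed

lemma legal_reply_at_point:
  assumes F: "strategy_ONE X F p" and p: "p \<in> P"
    and L: "\<And>U. U \<in> set L \<Longrightarrow> is_open X U p"
    and q: "q \<in> P" "q \<preceq> p" and x: "x \<in> topspace X"
  obtains r B U where "r \<in> P" "r \<preceq> q" "openin X B" "x \<in> B"
    "legal_reply F L U r" "\<And>y. y \<in> B \<Longrightarrow> in_sub y U r"
proof -
  have "(finite_open_seq X (seq_name L) \<^bold>\<longrightarrow>
      (\<^bold>\<exists>C. fMem (eq_pair eq_seq eq_fam) (seq_name L, C) F)) p"
    using F unfolding strategy_ONE_def is_function_def fAnd_def fAll_def by blast
  then have "(\<^bold>\<exists>C. fMem (eq_pair eq_seq eq_fam) (seq_name L, C) F) p"
    by (rule fImpD) (use p L in \<open>auto intro!: le_refl finite_open_seq_name regular_intros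
          regular_finite_open_seq\<close>)
  then obtain s C where s: "s \<in> P" "s \<preceq> q" "fMem (eq_pair eq_seq eq_fam) (seq_name L, C) F s"
    using q unfolding fEx_iff by blast
  have sp: "s \<preceq> p" using s q p le_trans by blast
  have cover: "open_cover X C s"
    using strategy_value_open_cover[OF F p s(1) sp s(3)] .
  then have "(ground (x \<in> topspace X) \<^bold>\<longrightarrow> (\<^bold>\<exists>U. in_fam U C \<^bold>\<and> in_sub x U)) s"
    unfolding open_cover_def fAnd_def fAll_def by blast
  then have "(\<^bold>\<exists>U. in_fam U C \<^bold>\<and> in_sub x U) s"
    by (rule fImpD) (use s x in \<open>auto simp: ground_iff intro!: le_refl regular_intros\<close>)
  then obtain t U where t: "t \<in> P" "t \<preceq> s" "in_fam U C t" "in_sub x U t"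
    using s(1) by (elim fExD) (auto simp: fAnd_def)
  have "open_cover X C t" using cover regular_open_cover regular_mono s t by blast
  then have "is_open X U t" using t open_cover_member_open by blast
  then obtain r B where r: "r \<in> P" "r \<preceq> t" "openin X B" "x \<in> B" "\<And>y. y \<in> B \<Longrightarrow> in_sub y U r"
    using is_open_basic t by metis
  have rs: "r \<preceq> s" using r s t le_trans by blast
  have "legal_reply F L U r"
    unfolding legal_reply_def
    by (rule fExI[where x = C]) (use regular_mono[OF regular_fMem s(3)] regular_mono[OF regular_in_fam t(3)]
        r s t rs in \<open>auto simp: fAnd_iff intro!: regular_intros\<close>)
  moreover have "r \<preceq> q" using rs r s q le_trans by blast
  ultimately show thesis using that r by blast
qed

text \<open>The reply must be legal in every extension in which the game is played, hence forced by \<open>p\<close>,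
  although only \<open>r\<close> is known to put \<open>B\<close> inside a legal reply. The maximal principle is
  therefore applied to "\<open>U\<close> is legal, and contains \<open>B\<close> if \<open>r\<close> is in the generic filter".\<close>

lemma legal_reply_extending:
  assumes F: "strategy_ONE X F p" and p: "p \<in> P"
    and L: "\<And>U. U \<in> set L \<Longrightarrow> is_open X U p"
    and X: "topspace X \<noteq> {}"
    and r: "r \<in> P" and V: "legal_reply F L V r" "\<And>y. y \<in> B \<Longrightarrow> in_sub y V r"
  obtains U where "legal_reply F L U p" "r \<preceq> p \<Longrightarrow> (\<And>y. y \<in> B \<Longrightarrow> in_sub y U r)"
proof -
  define \<phi> where "\<phi> U q \<longleftrightarrow> legal_reply F L U q \<and>
      (\<forall>s\<in>P. s \<preceq> q \<longrightarrow> s \<preceq> r \<longrightarrow> (\<forall>y\<in>B. in_sub y U s))" for U q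
  have "\<exists>U. \<phi> U p"
  proof (rule maximal_principle[OF p])
    show "regular (\<phi> U)" for U
    proof (rule regularI)
      fix q q' assume "q \<in> P" "q' \<in> P" "q' \<preceq> q" "\<phi> U q"
      then show "\<phi> U q'"
        unfolding \<phi>_def using regular_mono[OF regular_legal_reply] le_trans by meson
    next
      fix q assume q: "q \<in> P" and d: "\<And>q'. q' \<in> P \<Longrightarrow> q' \<preceq> q \<Longrightarrow> \<exists>s\<in>P. s \<preceq> q' \<and> \<phi> U s"
      have "legal_reply F L U q"
        using regular_dense[OF regular_legal_reply q] d unfolding \<phi>_def by blast
      moreover have "in_sub y U s" if s: "s \<in> P" "s \<preceq> q" "s \<preceq> r" "y \<in> B" for s y
      proof (rule regular_dense[OF regular_in_sub s(1)])
        fix s' assume s': "s' \<in> P" "s' \<preceq> s"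
        then obtain t where t: "t \<in> P" "t \<preceq> s'" "\<phi> U t" using d s q le_trans by blast
        moreover have "t \<preceq> r" using t s' s r le_trans by blast
        ultimately show "\<exists>t\<in>P. t \<preceq> s' \<and> in_sub y U t"
          using le_refl s unfolding \<phi>_def by blast
      qed
      ultimately show "\<phi> U q" unfolding \<phi>_def by blast
    qed
    show "\<phi> V' q" if "q \<in> P" "\<phi> U q" "eq_sub U V' q" for U V' q
      using that legal_reply_cong eq_sub_iff unfolding \<phi>_def by blast
    fix q assume q: "q \<in> P" "q \<preceq> p"
    show "\<exists>s\<in>P. s \<preceq> q \<and> (\<exists>U. \<phi> U s)"
    proof (cases "\<exists>s\<in>P. s \<preceq> q \<and> s \<preceq> r")
      case True
      then obtain s where s: "s \<in> P" "s \<preceq> q" "s \<preceq> r" by blast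
      then have "\<phi> V s"
        unfolding \<phi>_def
        using regular_mono[OF regular_legal_reply V(1) r]
          regular_mono[OF regular_in_sub V(2) r] by simp
      then show ?thesis using s by blast
    next
      case False
      \<comment> \<open>Any legal reply will do; a nonempty space guarantees that the cover has a member.\<close>
      obtain x where "x \<in> topspace X" using X by blast
      then obtain s U where s: "s \<in> P" "s \<preceq> q" "legal_reply F L U s"
        using legal_reply_at_point[OF F p L q] by metis
      moreover have "\<not> t \<preceq> r" if "t \<in> P" "t \<preceq> s" for t
        using False le_trans[OF that(1) s(1) q(1) that(2) s(2)] that(1) by blast
      ultimately have "\<phi> U s" unfolding \<phi>_def by simp
      then show ?thesis using s by blast
    qed
  qed
  then show thesis using that r le_refl unfolding \<phi>_def by blast
qed

text \<open>The only use of weak Lindelofness, and it takes place in the ground model: the cover consists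
  of the ground model sets that some extension of \<open>q\<close> puts inside a legal reply.\<close>

lemma dense_legal_replies:
  assumes F: "strategy_ONE X F p" and p: "p \<in> P"
    and L: "\<And>U. U \<in> set L \<Longrightarrow> is_open X U p"
    and X: "topspace X \<noteq> {}" "weakly_Lindelof X"
    and q: "q \<in> P" "q \<preceq> p"
  shows "\<exists>B r U. (\<forall>n::nat. openin X (B n) \<and> r n \<in> P \<and> r n \<preceq> q \<and> legal_reply F L (U n) p \<and>
            (\<forall>y\<in>B n. in_sub y (U n) (r n))) \<and>
          X closure_of (\<Union>n. B n) = topspace X"
proof -
  define \<U> where "\<U> = {B. openin X B \<and> (\<exists>r\<in>P. r \<preceq> q \<and> (\<exists>U. legal_reply F L U p \<and>
      (\<forall>y\<in>B. in_sub y U r)))}"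
  have "\<exists>B\<in>\<U>. x \<in> B" if x: "x \<in> topspace X" for x
  proof -
    obtain r B V where r: "r \<in> P" "r \<preceq> q" "openin X B" "x \<in> B"
      "legal_reply F L V r" "\<And>y. y \<in> B \<Longrightarrow> in_sub y V r"
      using legal_reply_at_point[OF F p L q x] by metis
    moreover have "r \<preceq> p" using r q p le_trans by blast
    ultimately obtain U where "legal_reply F L U p" "\<And>y. y \<in> B \<Longrightarrow> in_sub y U r"
      using legal_reply_extending[OF F p L X(1) r(1,5,6)] by metis
    then show ?thesis using r unfolding \<U>_def by blast
  qed
  moreover have "\<forall>B\<in>\<U>. openin X B" unfolding \<U>_def by blast
  ultimately have "\<Union>\<U> = topspace X" "\<forall>B\<in>\<U>. openin X B"
    using openin_subset[of X] by blast+
  then obtain \<V> where V: "\<V> \<subseteq> \<U>" "countable \<V>" "X closure_of \<Union>\<V> = topspace X"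
    using X(2) unfolding weakly_Lindelof_def by metis
  then have ne: "\<V> \<noteq> {}" using X(1) by (metis Union_empty closure_of_empty)
  define B where "B = from_nat_into \<V>"
  have range: "range B = \<V>" unfolding B_def using V ne by (simp add: range_from_nat_into)
  then have "B n \<in> \<U>" for n using V by blast
  then have "\<exists>r U. openin X (B n) \<and> r \<in> P \<and> r \<preceq> q \<and> legal_reply F L U p \<and>
            (\<forall>y\<in>B n. in_sub y U r)" for n
    unfolding \<U>_def by blast
  then obtain r U where "\<forall>n. openin X (B n) \<and> r n \<in> P \<and> r n \<preceq> q \<and> legal_reply F L (U n) p \<and>
            (\<forall>y\<in>B n. in_sub y (U n) (r n))" by metis
  then show ?thesis using V range by metis
qed

end

section \<open>Plays along a generic branch of a tree of moves\<close>

text \<open>The forcing adds a sequence of natural numbers, and \<open>node t\<close> is the condition that says that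
  the sequence begins with \<open>t\<close>.\<close>

locale generic_real = forcing_notion P le one
  for P :: "'p set" and le :: "'p \<Rightarrow> 'p \<Rightarrow> bool" (infix "\<preceq>" 50) and one :: 'p +
  fixes node :: "nat list \<Rightarrow> 'p"
  assumes node_in: "node t \<in> P"
    and node_take: "node t \<preceq> node (take i t)"
    and node_unique: "\<lbrakk>q \<in> P; q \<preceq> node s; q \<preceq> node t; length s = length t\<rbrakk> \<Longrightarrow> s = t"
    and node_dense: "q \<in> P \<Longrightarrow> \<exists>r\<in>P. r \<preceq> q \<and> (\<exists>t. length t = n \<and> r \<preceq> node t)"

text \<open>The moves of TWO on the way to the node \<open>t\<close> of the tree \<open>u\<close>.\<close>

definition position :: "(nat list \<Rightarrow> 'n) \<Rightarrow> nat list \<Rightarrow> 'n list" where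
  "position u t = map (\<lambda>i. u (take (Suc i) t)) [0..<length t]"

lemma length_position [simp]: "length (position u t) = length t"
  by (simp add: position_def)

lemma nth_position [simp]: "i < length t \<Longrightarrow> position u t ! i = u (take (Suc i) t)"
  by (simp add: position_def)

lemma position_snoc: "position u (t @ [k]) = position u t @ [u (t @ [k])]"
  by (simp add: position_def)

text \<open>The sequence of moves that results when TWO determines each move by a rule \<open>M\<close> from the
  previous moves and a further parameter, the parameters being the entries of \<open>s\<close>.\<close>

definition moves :: "('n list \<Rightarrow> 'c \<Rightarrow> 'n) \<Rightarrow> 'c list \<Rightarrow> 'n list" where
  "moves M s = foldl (\<lambda>L c. L @ [M L c]) [] s"

lemma moves_simps [simp]: "moves M [] = []" "moves M (s @ [c]) = moves M s @ [M (moves M s) c]"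
  by (simp_all add: moves_def)

lemma moves_map: "moves M (map f s) = moves (\<lambda>L c. M L (f c)) s"
  by (simp add: moves_def foldl_map)

lemma position_moves: "position (\<lambda>t. last (moves M t)) t = moves M t"
  by (induction t rule: rev_induct) (simp_all add: position_snoc, simp add: position_def)

lemma moves_all:
  assumes "\<And>L c. \<forall>U\<in>set L. Q U \<Longrightarrow> c \<in> C \<Longrightarrow> Q (M L c)" "set s \<subseteq> C"
  shows "\<forall>U\<in>set (moves M s). Q U"
  using assms(2) by (induction s rule: rev_induct) (use assms(1) in auto)

context generic_real
begin

text \<open>A tree \<open>u\<close> of moves of TWO and the generic sequence \<open>c\<close> give the sequence whose term number
  \<open>i\<close> is \<open>u (c|(i + 1))\<close>; the root \<open>u []\<close> is not a move.\<close>

definition branch :: "(nat list \<Rightarrow> ('a, 'p) nset) \<Rightarrow> (nat \<times> ('a, 'p) nset, 'p) nset" where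
  "branch u = {((length t, u (t @ [k])), node (t @ [k])) | t k. True}"

lemma term_at_branch_dense:
  assumes "term_at i U (branch u) p" "q \<in> P" "q \<preceq> p"
  obtains r t k where "r \<in> P" "r \<preceq> q" "length t = i" "r \<preceq> node (t @ [k])" "eq_sub U (u (t @ [k])) r"
  using assms unfolding term_at_def fMem_def branch_def
  by (fastforce simp: eq_pair_ground_sub)

text \<open>Below \<open>node t\<close> the branch is known up to \<open>t\<close>, because a condition is below only one
  node of each length.\<close>

lemma term_at_branch:
  assumes p: "p \<in> P" "p \<preceq> node t" and i: "i < length t"
  shows "term_at i U (branch u) p \<longleftrightarrow> eq_sub U (u (take (Suc i) t)) p"
proof
  assume a: "term_at i U (branch u) p"
  show "eq_sub U (u (take (Suc i) t)) p"
  proof (rule regular_dense[OF regular_eq_sub p(1)])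
    fix q assume q: "q \<in> P" "q \<preceq> p"
    obtain r t' k where r: "r \<in> P" "r \<preceq> q" "length t' = i" "r \<preceq> node (t' @ [k])"
      "eq_sub U (u (t' @ [k])) r"
      using term_at_branch_dense[OF a q] .
    have "r \<preceq> p" using le_trans[OF r(1) q(1) p(1) r(2) q(2)] .
    then have "r \<preceq> node t" using le_trans[OF r(1) p(1) node_in _ p(2)] by blast
    then have "r \<preceq> node (take (Suc i) t)"
      using le_trans[OF r(1) node_in node_in _ node_take] by blast
    then have "t' @ [k] = take (Suc i) t"
      using node_unique[OF r(1,4)] r(3) i by simp
    then show "\<exists>r\<in>P. r \<preceq> q \<and> eq_sub U (u (take (Suc i) t)) r"
      using r by auto
  qed
next
  assume a: "eq_sub U (u (take (Suc i) t)) p"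
  have "((length (take i t), u (take i t @ [t ! i])), node (take i t @ [t ! i])) \<in> branch u"
    unfolding branch_def by blast
  then have mem: "((i, u (take (Suc i) t)), node (take (Suc i) t)) \<in> branch u"
    using i by (simp add: take_Suc_conv_app_nth)
  show "term_at i U (branch u) p"
    unfolding term_at_def fMem_def
  proof (intro ballI impI)
    fix q assume q: "q \<in> P" "q \<preceq> p"
    have "q \<preceq> node t" using le_trans[OF q(1) p(1) node_in q(2) p(2)] .
    then have "q \<preceq> node (take (Suc i) t)"
      using le_trans[OF q(1) node_in node_in _ node_take] by blast
    moreover have "eq_pair eq_ground eq_sub (i, U) (i, u (take (Suc i) t)) q"
      using eq_sub_mono[OF a p(1) q] by (simp add: eq_pair_ground_sub)
    ultimately have "\<exists>(y, r)\<in>branch u. r \<in> P \<and> q \<preceq> r \<and> eq_pair eq_ground eq_sub (i, U) y q"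
      using mem node_in by (intro bexI[OF _ mem]) simp
    then show "\<exists>q'\<in>P. q' \<preceq> q \<and>
        (\<exists>(y, r)\<in>branch u. r \<in> P \<and> q' \<preceq> r \<and> eq_pair eq_ground eq_sub (i, U) y q')"
      using q le_refl by blast
  qed
qed

lemma term_at_branch_open:
  assumes p: "p \<in> P" and u: "\<And>t k. is_open X (u (t @ [k])) p"
    and q: "q \<in> P" "q \<preceq> p" and U: "term_at i U (branch u) q"
  shows "is_open X U q"
proof (rule regular_dense[OF regular_is_open q(1)])
  fix s assume s: "s \<in> P" "s \<preceq> q"
  obtain r t k where r: "r \<in> P" "r \<preceq> s" "eq_sub U (u (t @ [k])) r"
    using term_at_branch_dense[OF U s] by metis
  have "r \<preceq> p" using r s q p le_trans by meson
  then have "is_open X (u (t @ [k])) r" using regular_mono[OF regular_is_open u p r(1)] by blast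
  then show "\<exists>r\<in>P. r \<preceq> s \<and> is_open X U r"
    using r is_open_cong[OF _ eq_sub_sym] by blast
qed

lemma infinite_open_seq_branch:
  assumes p: "p \<in> P" and u: "\<And>t k. is_open X (u (t @ [k])) p"
  shows "infinite_open_seq X (branch u) p"
proof -
  have "(term_at i U (branch u) \<^bold>\<longrightarrow> ground (i \<in> UNIV) \<^bold>\<and> is_open X U) p" for i U
    using term_at_branch_open[where u = u, OF p u] by (intro fImpI[OF p]) (simp add: fAnd_iff ground_iff)
  moreover have "(ground (i \<in> UNIV) \<^bold>\<longrightarrow> (\<^bold>\<exists>U. term_at i U (branch u))) p" for i
  proof (rule fImpI[OF p])
    fix q assume "q \<in> P" "q \<preceq> p"
    have "\<exists>r\<in>P. r \<preceq> s \<and> (\<exists>U. term_at i U (branch u) r)" if s: "s \<in> P" for s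
    proof -
      obtain r t where "r \<in> P" "r \<preceq> s" "length t = Suc i" "r \<preceq> node t"
        using node_dense[OF s] by blast
      then show ?thesis using term_at_branch[of r t i "u t" u] eq_sub_refl[of r "u t"] by auto
    qed
    then show "(\<^bold>\<exists>U. term_at i U (branch u)) q" unfolding fEx_iff by blast
  qed
  moreover have "(term_at i U (branch u) \<^bold>\<and> term_at i U' (branch u) \<^bold>\<longrightarrow> eq_sub U U') p" for i U U'
  proof (rule fImpI[OF p])
    fix q assume q: "q \<in> P" and a: "(term_at i U (branch u) \<^bold>\<and> term_at i U' (branch u)) q"
    show "eq_sub U U' q"
    proof (rule regular_dense[OF regular_eq_sub q])
      fix s assume s: "s \<in> P" "s \<preceq> q"
      obtain r t where r: "r \<in> P" "r \<preceq> s" "length t = Suc i" "r \<preceq> node t"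
        using node_dense[OF s(1)] by blast
      have "r \<preceq> q" using le_trans[OF r(1) s(1) q r(2) s(2)] .
      then have "term_at i U (branch u) r" "term_at i U' (branch u) r"
        using a regular_mono[OF regular_term_at _ q r(1)] unfolding fAnd_iff by blast+
      then have "eq_sub U U' r"
        using term_at_branch[OF r(1,4)] r(3) eq_sub_sym[OF r(1)] eq_sub_trans[OF r(1)]
        by (metis lessI)
      then show "\<exists>r\<in>P. r \<preceq> s \<and> eq_sub U U' r" using r by blast
    qed
  qed
  ultimately show ?thesis
    unfolding infinite_open_seq_def is_function_def term_at_def by (simp add: fAnd_iff fAll_iff)
qed

lemma initial_segment_branch:
  assumes p: "p \<in> P" "p \<preceq> node t"
  shows "initial_segment (seq_name (position u t)) (length t) (branch u) p"
proof -
  have "term_at i U (seq_name (position u t)) q =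
      (ground (i < length t) \<^bold>\<and> term_at i U (branch u)) q" if "q \<in> P" "q \<preceq> p" for i U q
    using term_at_seq_name[OF that(1), of i U "position u t"]
      term_at_branch[OF that(1) le_trans[OF that(1) p(1) node_in that(2) p(2)], of i U u]
    by (auto simp: fAnd_iff ground_iff)
  then show ?thesis
    unfolding initial_segment_def fAll_iff
      fIff_iff[OF p(1) regular_term_at regular_fAnd[OF regular_ground regular_term_at]]
    by blast
qed

lemma play_following_branch:
  assumes F: "strategy_ONE X F p" and p: "p \<in> P"
    and legal: "\<And>t k. legal_reply F (position u t) (u (t @ [k])) p"
  shows "play_following X F (branch u) p"
proof -
  let ?\<phi> = "\<lambda>n s C U. initial_segment s n (branch u) \<^bold>\<and> fMem (eq_pair eq_seq eq_fam) (s, C) F \<^bold>\<and>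
         term_at n U (branch u) \<^bold>\<and> in_fam U C"
  have reg: "regular (?\<phi> n s C U)" for n s C U
    unfolding initial_segment_def by (intro regular_intros)
  have "(\<^bold>\<exists>s. \<^bold>\<exists>C. \<^bold>\<exists>U. ?\<phi> n s C U) p" for n
  proof (rule regular_dense[OF _ p])
    show "regular (\<^bold>\<exists>s. \<^bold>\<exists>C. \<^bold>\<exists>U. ?\<phi> n s C U)"
      by (intro regular_fEx reg)
    fix q assume q: "q \<in> P" "q \<preceq> p"
    obtain r t' where r: "r \<in> P" "r \<preceq> q" "length t' = Suc n" "r \<preceq> node t'"
      using node_dense[OF q(1)] by blast
    obtain t k where t': "t' = t @ [k]" and n: "length t = n"
      using r(3) by (metis length_Suc_conv_rev)
    have "legal_reply F (position u t) (u t') r"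
      using regular_mono[OF regular_legal_reply legal p r(1) le_trans[OF r(1) q(1) p r(2) q(2)]]
      unfolding t' .
    then obtain s C where s: "s \<in> P" "s \<preceq> r"
      "fMem (eq_pair eq_seq eq_fam) (seq_name (position u t), C) F s" "in_fam (u t') C s"
      using r(1) unfolding legal_reply_def by (elim fExD) (auto simp: fAnd_iff)
    have st': "s \<preceq> node t'" using le_trans[OF s(1) r(1) node_in s(2) r(4)] .
    have st: "s \<preceq> node t"
      using le_trans[OF s(1) node_in node_in st' node_take[of t' n]] t' n by simp
    have "term_at n (u t') (branch u) s"
      using term_at_branch[OF s(1) st', of n "u t'" u] r(3) eq_sub_refl[OF s(1), of "u t'"] by simp
    then have 1: "?\<phi> n (seq_name (position u t)) C (u t') s"
      using s initial_segment_branch[OF s(1) st] n by (simp add: fAnd_iff)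
    have 2: "(\<^bold>\<exists>U. ?\<phi> n (seq_name (position u t)) C U) s"
      by (rule fExI[where x = "u t'"], rule 1, rule s(1), rule reg)
    have 3: "(\<^bold>\<exists>C. \<^bold>\<exists>U. ?\<phi> n (seq_name (position u t)) C U) s"
      by (rule fExI[where x = C], rule 2, rule s(1), intro regular_fEx reg)
    have "(\<^bold>\<exists>s. \<^bold>\<exists>C. \<^bold>\<exists>U. ?\<phi> n s C U) s"
      by (rule fExI[where x = "seq_name (position u t)"], rule 3, rule s(1), intro regular_fEx reg)
    moreover have "s \<preceq> q" using le_trans[OF s(1) r(1) q(1) s(2) r(2)] .
    ultimately show "\<exists>r\<in>P. r \<preceq> q \<and> (\<^bold>\<exists>s. \<^bold>\<exists>C. \<^bold>\<exists>U. ?\<phi> n s C U) r"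
      using s(1) by blast
  qed
  moreover have "is_open X (u (t @ [k])) p" for t k
    using legal_reply_open[OF F p legal] .
  ultimately show ?thesis
    using infinite_open_seq_branch[OF p] unfolding play_following_def fAnd_iff fAll_iff by blast
qed

text \<open>For density it suffices to meet the nonempty ground model open sets \<open>B\<close>, by
  \<open>is_open_basic\<close>; the premise says that this happens densely often.\<close>

lemma TWO_wins_branch:
  assumes p: "p \<in> P" and u: "\<And>t k. is_open X (u (t @ [k])) p"
    and generic: "\<And>q B. \<lbrakk>q \<in> P; q \<preceq> p; openin X B; B \<noteq> {}\<rbrakk> \<Longrightarrow>
      \<exists>r\<in>P. r \<preceq> q \<and> (\<exists>t k. r \<preceq> node (t @ [k]) \<and> (\<exists>x\<in>B. in_sub x (u (t @ [k])) r))"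
  shows "TWO_wins X (branch u) p"
proof -
  define D where "D = {(u (t @ [k]), node (t @ [k])) | t k. True}"
  have in_D: "in_fam (u (t @ [k])) D q" if "q \<in> P" "q \<preceq> node (t @ [k])" for q t k
    unfolding in_fam_def fMem_def D_def
  proof (intro ballI impI)
    fix s assume s: "s \<in> P" "s \<preceq> q"
    then have "s \<preceq> node (t @ [k])" using le_trans that node_in by blast
    then show "\<exists>q'\<in>P. q' \<preceq> s \<and> (\<exists>(y, r)\<in>{(u (t @ [k]), node (t @ [k])) |t k. True}.
        r \<in> P \<and> q' \<preceq> r \<and> eq_sub (u (t @ [k])) y q')"
      using s(1) le_refl[OF s(1)] eq_sub_refl[OF s(1), of "u (t @ [k])"] node_in by blast
  qed
  have D_term: "in_fam U D q \<longleftrightarrow> (\<^bold>\<exists>n. term_at n U (branch u)) q" if q: "q \<in> P" for U q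
  proof
    assume a: "in_fam U D q"
    show "(\<^bold>\<exists>n. term_at n U (branch u)) q"
      unfolding fEx_iff
    proof (intro ballI impI)
      fix s assume "s \<in> P" "s \<preceq> q"
      then obtain r t k where r: "r \<in> P" "r \<preceq> s" "r \<preceq> node (t @ [k])" "eq_sub U (u (t @ [k])) r"
        using a unfolding in_fam_def fMem_def D_def by fast
      then have "term_at (length t) U (branch u) r"
        using term_at_branch[of r "t @ [k]" "length t" U u] by simp
      then show "\<exists>r\<in>P. r \<preceq> s \<and> (\<exists>n. term_at n U (branch u) r)" using r by blast
    qed
  next
    assume a: "(\<^bold>\<exists>n. term_at n U (branch u)) q"
    show "in_fam U D q"
    proof (rule regular_dense[OF regular_in_fam q])
      fix s assume s: "s \<in> P" "s \<preceq> q"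
      then obtain s' n where s': "s' \<in> P" "s' \<preceq> s" "term_at n U (branch u) s'"
        using a unfolding fEx_iff by blast
      obtain r t k where r: "r \<in> P" "r \<preceq> s'" "r \<preceq> node (t @ [k])" "eq_sub U (u (t @ [k])) r"
        using term_at_branch_dense[OF s'(3,1) le_refl[OF s'(1)]] by metis
      have "in_fam U D r"
        using in_fam_cong[OF in_D[OF r(1,3)] eq_sub_sym[OF r(1,4)] r(1)] .
      then show "\<exists>r\<in>P. r \<preceq> s \<and> in_fam U D r"
        using r(1) le_trans[OF r(1) s'(1) s(1) r(2) s'(2)] by blast
    qed
  qed
  have "(in_fam U D \<^bold>\<longleftrightarrow> (\<^bold>\<exists>n. term_at n U (branch u))) p" for U
    unfolding fIff_iff[OF p regular_in_fam regular_fEx[OF regular_term_at]] using D_term by blast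
  moreover have "(in_fam U D \<^bold>\<longrightarrow> is_open X U) p" for U
  proof (rule fImpI[OF p])
    fix q assume q: "q \<in> P" "q \<preceq> p" "in_fam U D q"
    show "is_open X U q"
    proof (rule regular_dense[OF regular_is_open q(1)])
      fix s assume s: "s \<in> P" "s \<preceq> q"
      then obtain r n where r: "r \<in> P" "r \<preceq> s" "term_at n U (branch u) r"
        using q(3) unfolding D_term[OF q(1)] fEx_iff by blast
      have "r \<preceq> p" using r s q p le_trans by meson
      then show "\<exists>r\<in>P. r \<preceq> s \<and> is_open X U r"
        using r term_at_branch_open[where u = u, OF p u r(1) _ r(3)] by blast
    qed
  qed
  moreover have "(is_open X W \<^bold>\<and> (\<^bold>\<exists>x. in_sub x W) \<^bold>\<longrightarrow>
      (\<^bold>\<exists>U. in_fam U D \<^bold>\<and> (\<^bold>\<exists>x. in_sub x U \<^bold>\<and> in_sub x W))) p" for W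
  proof (rule fImpI[OF p])
    fix q assume q: "q \<in> P" "q \<preceq> p" "(is_open X W \<^bold>\<and> (\<^bold>\<exists>x. in_sub x W)) q"
    show "(\<^bold>\<exists>U. in_fam U D \<^bold>\<and> (\<^bold>\<exists>x. in_sub x U \<^bold>\<and> in_sub x W)) q"
    proof (rule regular_dense[OF _ q(1)])
      show "regular (\<^bold>\<exists>U. in_fam U D \<^bold>\<and> (\<^bold>\<exists>x. in_sub x U \<^bold>\<and> in_sub x W))"
        by (intro regular_intros)
      fix s assume s: "s \<in> P" "s \<preceq> q"
      then obtain s1 x where s1: "s1 \<in> P" "s1 \<preceq> s" "in_sub x W s1"
        using q(3) unfolding fAnd_iff fEx_iff by blast
      have s1q: "s1 \<preceq> q" using le_trans[OF s1(1) s(1) q(1) s1(2) s(2)] .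
      then have "is_open X W s1"
        using q(3) regular_mono[OF regular_is_open _ q(1) s1(1)] unfolding fAnd_iff by blast
      then obtain s2 B where s2: "s2 \<in> P" "s2 \<preceq> s1" "openin X B" "x \<in> B"
        "\<And>y. y \<in> B \<Longrightarrow> in_sub y W s2"
        using is_open_basic s1 by metis
      have s2q: "s2 \<preceq> q" using le_trans[OF s2(1) s1(1) q(1) s2(2) s1q] .
      have "s2 \<preceq> p" using le_trans[OF s2(1) q(1) p s2q q(2)] .
      then obtain r t k y where r: "r \<in> P" "r \<preceq> s2" "r \<preceq> node (t @ [k])" "y \<in> B"
        "in_sub y (u (t @ [k])) r"
        using generic[of s2 B] s2 by blast
      have "in_sub y W r" using regular_mono[OF regular_in_sub s2(5)[OF r(4)] s2(1) r(1,2)] .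
      then have "(\<^bold>\<exists>x. in_sub x (u (t @ [k])) \<^bold>\<and> in_sub x W) r"
        by (intro fExI[where x = y]) (use r in \<open>auto simp: fAnd_iff intro!: regular_intros\<close>)
      then have "(\<^bold>\<exists>U. in_fam U D \<^bold>\<and> (\<^bold>\<exists>x. in_sub x U \<^bold>\<and> in_sub x W)) r"
        by (intro fExI[where x = "u (t @ [k])"])
          (use r in_D[OF r(1,3)] in \<open>auto simp: fAnd_iff intro!: regular_intros\<close>)
      moreover have "r \<preceq> s"
        using r s2 s1 s le_trans by meson
      ultimately show "\<exists>r\<in>P. r \<preceq> s \<and> (\<^bold>\<exists>U. in_fam U D \<^bold>\<and> (\<^bold>\<exists>x. in_sub x U \<^bold>\<and> in_sub x W)) r"
        using r(1) by blast
    qed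
  qed
  ultimately have D: "((\<^bold>\<forall>U. in_fam U D \<^bold>\<longleftrightarrow> (\<^bold>\<exists>n. term_at n U (branch u))) \<^bold>\<and> dense_family X D) p"
    unfolding dense_family_def fAnd_iff fAll_iff by blast
  show ?thesis
    unfolding TWO_wins_def
    by (rule fExI[where x = D], rule D, rule p)
      (unfold dense_family_def, intro regular_intros regular_is_open)
qed

end

context forcing_notion
begin

text \<open>The play may depend on the condition \<open>q\<close>, since a condition forces a negation as soon as no
  stronger condition forces the negated sentence.\<close>

lemma no_winning_strategy_if_defeated:
  assumes p: "p \<in> P"
    and T: "\<And>F q. \<lbrakk>q \<in> P; strategy_ONE X F q\<rbrakk> \<Longrightarrow> \<exists>T. play_following X F T q \<and> TWO_wins X T q"
  shows "no_winning_strategy_ONE X p"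
proof -
  have "\<not> winning_strategy_ONE X F q" if q: "q \<in> P" for F q
  proof
    assume a: "winning_strategy_ONE X F q"
    then obtain T where T: "play_following X F T q" "TWO_wins X T q"
      using T[OF q] unfolding winning_strategy_ONE_def fAnd_iff by blast
    have "(play_following X F T \<^bold>\<longrightarrow> (\<^bold>\<not> TWO_wins X T)) q"
      using a unfolding winning_strategy_ONE_def fAnd_iff fAll_iff by blast
    then obtain r where r: "r \<in> P" "r \<preceq> q" "\<not> TWO_wins X T r"
      using T(1) q le_refl[OF q] le_refl unfolding fImp_def fNot_def fAnd_iff by blast
    have "TWO_wins X T r"
      using T(2) r q le_trans unfolding TWO_wins_def fEx_iff[where p = q] fEx_iff[where p = r]
      by (meson le_trans)
    then show False using r by blast
  qed
  then show ?thesis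
    unfolding no_winning_strategy_ONE_def fNot_def[of "fEx _"] fEx_iff using p le_refl by blast
qed

end

section \<open>Cohen conditions\<close>

definition cohen_node :: "'k \<Rightarrow> nat list \<Rightarrow> ('k \<times> nat \<rightharpoonup> nat)" where
  "cohen_node \<alpha> t = (\<lambda>(\<beta>, i). if \<beta> = \<alpha> \<and> i < length t then Some (t ! i) else None)"

lemma dom_cohen_node: "dom (cohen_node \<alpha> t) = {\<alpha>} \<times> {..<length t}"
  by (auto simp: cohen_node_def dom_def split: if_splits)

lemma cohen_node_in: "\<alpha> \<in> Field \<kappa> \<Longrightarrow> cohen_node \<alpha> t \<in> cohen \<kappa>"
  by (auto simp: cohen_def dom_cohen_node)

lemma cohen_node_le_iff:
  "cohen_le q (cohen_node \<alpha> t) \<longleftrightarrow> (\<forall>i<length t. q (\<alpha>, i) = Some (t ! i))"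
  by (auto simp: cohen_le_def map_le_def dom_cohen_node) (auto simp: cohen_node_def)

text \<open>The gaps among the first \<open>n\<close> values of the real at \<open>\<alpha>\<close> are filled with \<open>0\<close>. The
  domain of \<open>r\<close> is recorded because genericity needs the next value to stay undecided.\<close>

lemma cohen_extend_to_node:
  assumes q: "q \<in> cohen \<kappa>" and \<alpha>: "\<alpha> \<in> Field \<kappa>"
  obtains r t where "r \<in> cohen \<kappa>" "cohen_le r q" "cohen_le r (cohen_node \<alpha> t)" "length t = n"
    "dom r = dom q \<union> {\<alpha>} \<times> {..<n}"
proof -
  define t where "t = map (\<lambda>i. case q (\<alpha>, i) of None \<Rightarrow> 0 | Some v \<Rightarrow> v) [0..<n]"
  define r where "r = cohen_node \<alpha> t ++ q"
  have t: "length t = n" by (simp add: t_def)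
  have dom: "dom r = dom q \<union> {\<alpha>} \<times> {..<n}" by (simp add: r_def dom_cohen_node t)
  have "r \<in> cohen \<kappa>" using q \<alpha> by (auto simp: cohen_def dom)
  moreover have "cohen_le r q" by (simp add: r_def cohen_le_def)
  moreover have "cohen_le r (cohen_node \<alpha> t)"
    by (auto simp: cohen_node_le_iff r_def t map_add_def split: option.split)
      (auto simp: cohen_node_def t_def)
  ultimately show thesis using that t dom by blast
qed

lemma generic_real_cohen:
  assumes \<alpha>: "\<alpha> \<in> Field \<kappa>"
  shows "generic_real (cohen \<kappa>) cohen_le Map.empty (cohen_node \<alpha>)"
proof -
  interpret forcing_notion "cohen \<kappa>" cohen_le Map.empty by (rule forcing_notion_cohen)
  show ?thesis
  proof
    show "cohen_node \<alpha> t \<in> cohen \<kappa>" for t using \<alpha> by (rule cohen_node_in)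
    show "cohen_le (cohen_node \<alpha> t) (cohen_node \<alpha> (take i t))" for t i
      by (auto simp: cohen_node_le_iff) (simp add: cohen_node_def)
    show "s = t" if "cohen_le q (cohen_node \<alpha> s)" "cohen_le q (cohen_node \<alpha> t)"
      "length s = length t" for q s t
      using that by (auto simp: cohen_node_le_iff intro: nth_equalityI)
    show "\<exists>r\<in>cohen \<kappa>. cohen_le r q \<and> (\<exists>t. length t = n \<and> cohen_le r (cohen_node \<alpha> t))"
      if "q \<in> cohen \<kappa>" for q n
      using cohen_extend_to_node[OF that \<alpha>] by metis
  qed
qed

text \<open>A finite partial function is determined by its graph, a finite subset of a countable set.\<close>

lemma countable_finite_maps:
  assumes "countable D"
  shows "countable {f :: 'a \<rightharpoonup> 'b :: countable. finite (dom f) \<and> dom f \<subseteq> D}"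
proof (rule countable_image_inj_on)
  have "Map.graph f = (\<lambda>x. (x, the (f x))) ` dom f" for f :: "'a \<rightharpoonup> 'b"
    by (auto simp: graph_def image_def)
  then have "Map.graph ` {f :: 'a \<rightharpoonup> 'b. finite (dom f) \<and> dom f \<subseteq> D} \<subseteq>
      {G. finite G \<and> G \<subseteq> D \<times> UNIV}" by auto
  then show "countable (Map.graph ` {f :: 'a \<rightharpoonup> 'b. finite (dom f) \<and> dom f \<subseteq> D})"
    using countable_Collect_finite_subset[of "D \<times> (UNIV :: 'b set)"] assms countable_subset by blast
  show "inj_on Map.graph {f :: 'a \<rightharpoonup> 'b. finite (dom f) \<and> dom f \<subseteq> D}"
  proof (rule inj_onI, rule ext)
    fix f g :: "'a \<rightharpoonup> 'b" and x assume "Map.graph f = Map.graph g"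
    then have "f x = Some y \<longleftrightarrow> g x = Some y" for y by (auto simp: graph_def set_eq_iff)
    then show "f x = g x" by (metis option.exhaust)
  qed
qed

text \<open>Closing off \<open>\<omega>\<close> times is enough, because \<open>h\<close> is only applied to finite sets and each finite
  subset of the union of the stages is contained in a single stage.\<close>

lemma countable_closure:
  fixes h :: "'k set \<Rightarrow> 'k set"
  assumes "countable A\<^sub>0" and h: "\<And>E. finite E \<Longrightarrow> countable (h E)"
  obtains A where "countable A" "A\<^sub>0 \<subseteq> A" "\<And>E. finite E \<Longrightarrow> E \<subseteq> A \<Longrightarrow> h E \<subseteq> A"
proof -
  define S where "S = rec_nat A\<^sub>0 (\<lambda>_ A. A \<union> \<Union>(h ` {E. finite E \<and> E \<subseteq> A}))"
  have S: "S 0 = A\<^sub>0" "S (Suc n) = S n \<union> \<Union>(h ` {E. finite E \<and> E \<subseteq> S n})" for n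
    by (simp_all add: S_def)
  have mono: "m \<le> n \<Longrightarrow> S m \<subseteq> S n" for m n by (rule lift_Suc_mono_le) (auto simp: S)
  have "countable (S n)" for n
    by (induction n) (auto simp: S assms(1) intro!: countable_UN countable_Collect_finite_subset h)
  then have "countable (\<Union>n. S n)" by blast
  moreover have "h E \<subseteq> (\<Union>n. S n)" if "finite E" "E \<subseteq> (\<Union>n. S n)" for E
  proof -
    have "\<exists>n. E \<subseteq> S n"
      using that
    proof (induction E)
      case (insert x E)
      then obtain m n where "x \<in> S m" "E \<subseteq> S n" by blast
      then have "insert x E \<subseteq> S (max m n)" using mono[of m "max m n"] mono[of n "max m n"] by auto
      then show ?case ..
    qed simp
    then obtain n where "E \<subseteq> S n" ..
    then have "h E \<subseteq> S (Suc n)" using that by (auto simp: S)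
    then show ?thesis by blast
  qed
  ultimately show thesis using that[of "\<Union>n. S n"] S(1) by blast
qed

lemma uncountable_Field:
  assumes "Card_order \<kappa>" "natLeq <o \<kappa>"
  shows "\<not> countable (Field \<kappa>)"
proof
  assume "countable (Field \<kappa>)"
  then have "|Field \<kappa>| \<le>o natLeq" by (simp add: countable_card_le_natLeq)
  then have "\<kappa> \<le>o natLeq"
    using card_of_Field_ordIso[OF assms(1)] ordIso_ordLeq_trans ordIso_symmetric by blast
  then show False using assms(2) not_ordLess_ordLeq by blast
qed

section \<open>ONE has no winning strategy\<close>

text \<open>Here \<open>B\<close>, \<open>R\<close> and \<open>M\<close> are the sets, conditions and replies of
  \<open>dense_legal_replies\<close>, chosen for each position and each condition, and \<open>Q A\<close> consists
  of the conditions below \<open>p\<close> that are supported by \<open>A\<close>.\<close>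

lemma cohen_real_defeats_strategy:
  fixes \<kappa> :: "'k rel" and X :: "'a topology"
  assumes unc: "\<not> countable (Field \<kappa>)" and X: "topspace X \<noteq> {}" "weakly_Lindelof X"
    and p: "p \<in> cohen \<kappa>" and F: "forcing_notion.strategy_ONE (cohen \<kappa>) cohen_le X F p"
  shows "\<exists>T. forcing_notion.play_following (cohen \<kappa>) cohen_le X F T p \<and>
    forcing_notion.TWO_wins (cohen \<kappa>) cohen_le X T p"
proof -
  interpret forcing_notion "cohen \<kappa>" cohen_le Map.empty by (rule forcing_notion_cohen)
  define Q where "Q A = {q \<in> cohen \<kappa>. cohen_le q p \<and> dom q \<subseteq> A \<times> UNIV}" for A
  define good where "good L \<longleftrightarrow> (\<forall>U\<in>set L. is_open X U p)" for L
  define \<Phi> where "\<Phi> L q B r U \<longleftrightarrow> (\<forall>n::nat. openin X (B n) \<and> r n \<in> cohen \<kappa> \<and> cohen_le (r n) q \<and>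
        legal_reply F L (U n) p \<and> (\<forall>y\<in>B n. in_sub y (U n) (r n))) \<and>
      X closure_of (\<Union>n. B n) = topspace X" for L q B r U
  have "\<exists>B r U. \<Phi> L q B r U" if "good L" "q \<in> cohen \<kappa>" "cohen_le q p" for L q
    unfolding \<Phi>_def
    by (rule dense_legal_replies[OF F p _ X that(2,3)]) (use that(1) in \<open>simp add: good_def\<close>)
  then have "\<forall>L q. \<exists>B r U. good L \<and> q \<in> cohen \<kappa> \<and> cohen_le q p \<longrightarrow> \<Phi> L q B r U" by blast
  then obtain B R M where BRM: "\<And>L q. \<lbrakk>good L; q \<in> cohen \<kappa>; cohen_le q p\<rbrakk> \<Longrightarrow>
      \<Phi> L q (B L q) (R L q) (M L q)"
    by metis
  define mv where "mv = moves (\<lambda>L (q, n). M L q n)"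
  have good_mv: "good (mv s)" if "set s \<subseteq> Q A \<times> UNIV" for s A
    unfolding good_def mv_def
  proof (rule moves_all[OF _ that])
    fix L and c :: "('k \<times> nat \<rightharpoonup> nat) \<times> nat" assume L: "\<forall>U\<in>set L. is_open X U p" and c: "c \<in> Q A \<times> UNIV"
    then have "\<Phi> L (fst c) (B L (fst c)) (R L (fst c)) (M L (fst c))"
      by (intro BRM) (auto simp: good_def Q_def)
    then have "legal_reply F L (M L (fst c) (snd c)) p" unfolding \<Phi>_def by blast
    then show "is_open X (case c of (q, n) \<Rightarrow> M L q n) p"
      using legal_reply_open[OF F p] by (simp add: case_prod_beta)
  qed
  have BRM_mv: "\<Phi> (mv s) q (B (mv s) q) (R (mv s) q) (M (mv s) q)"
    if "set s \<subseteq> Q A \<times> UNIV" "q \<in> Q A" for s q A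
    using BRM good_mv[OF that(1)] that(2) unfolding Q_def by blast
  have countable_Q: "countable (Q A)" if "countable A" for A
    by (rule countable_subset[OF _ countable_finite_maps[of "A \<times> UNIV"]])
      (use that in \<open>auto simp: Q_def cohen_def\<close>)
  \<comment> \<open>The coordinates used by the conditions that arise from labels supported by \<open>E\<close>.\<close>
  define h where "h E = (\<Union>(s, q, n) \<in> lists (Q E \<times> UNIV) \<times> Q E \<times> UNIV. fst ` dom (R (mv s) q n))" for E
  have "countable (h E)" if "finite E" for E
    unfolding h_def
  proof (rule countable_UN)
    show "countable (lists (Q E \<times> (UNIV :: nat set)) \<times> Q E \<times> (UNIV :: nat set))"
      by (intro countable_SIGMA countable_lists countableI_type
          countable_Q[OF countable_finite[OF that]])
    fix z assume "z \<in> lists (Q E \<times> (UNIV :: nat set)) \<times> Q E \<times> (UNIV :: nat set)"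
    then obtain s q n where z: "z = (s, q, n)" "set s \<subseteq> Q E \<times> UNIV" "q \<in> Q E" by auto
    have "R (mv s) q n \<in> cohen \<kappa>" using BRM_mv[OF z(2,3)] unfolding \<Phi>_def by blast
    then show "countable (case z of (s, q, n) \<Rightarrow> fst ` dom (R (mv s) q n))"
      using z(1) by (simp add: cohen_def countable_finite)
  qed
  moreover have "countable (fst ` dom p)" using p by (simp add: cohen_def countable_finite)
  ultimately obtain A where A: "countable A" "fst ` dom p \<subseteq> A"
    and closed: "\<And>E. finite E \<Longrightarrow> E \<subseteq> A \<Longrightarrow> h E \<subseteq> A"
    using countable_closure by metis
  have R_supp: "dom (R (mv s) q n) \<subseteq> A \<times> UNIV" if s: "set s \<subseteq> Q A \<times> UNIV" and q: "q \<in> Q A" for s q n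
  proof -
    \<comment> \<open>Only finitely many coordinates occur in the labels \<open>s\<close> and in \<open>q\<close>.\<close>
    define E where "E = (\<Union>q'\<in>insert q (fst ` set s). fst ` dom q')"
    have sub: "insert q (fst ` set s) \<subseteq> Q A" using s q by auto
    then have fin: "finite (dom q')" if "q' \<in> insert q (fst ` set s)" for q'
      using that unfolding Q_def cohen_def by blast
    then have "finite E" unfolding E_def by blast
    moreover have "E \<subseteq> A" using sub unfolding E_def Q_def by fastforce
    ultimately have "h E \<subseteq> A" by (rule closed)
    have "insert q (fst ` set s) \<subseteq> Q E"
    proof
      fix q' assume q': "q' \<in> insert q (fst ` set s)"
      then have "dom q' \<subseteq> E \<times> UNIV" unfolding E_def by (auto simp: image_iff) force+
      then show "q' \<in> Q E" using sub q' unfolding Q_def by blast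
    qed
    then have "(s, q, n) \<in> lists (Q E \<times> UNIV) \<times> Q E \<times> UNIV"
      by (auto simp: image_subset_iff mem_Times_iff)
    then have "fst ` dom (R (mv s) q n) \<subseteq> h E" unfolding h_def by blast
    then show ?thesis using \<open>h E \<subseteq> A\<close> by fastforce
  qed
  have "\<not> Field \<kappa> \<subseteq> A" using unc countable_subset[OF _ A(1)] by blast
  then obtain \<alpha> where \<alpha>: "\<alpha> \<in> Field \<kappa>" "\<alpha> \<notin> A" by blast
  interpret generic_real "cohen \<kappa>" cohen_le Map.empty "cohen_node \<alpha>"
    using \<alpha>(1) by (rule generic_real_cohen)
  have "p \<in> Q A" using p A(2) le_refl unfolding Q_def by fastforce
  define dec where "dec = from_nat_into (Q A \<times> (UNIV :: nat set))"
  have range_dec: "range dec = Q A \<times> UNIV"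
    unfolding dec_def using \<open>p \<in> Q A\<close> countable_Q[OF A(1)]
    by (intro range_from_nat_into) auto
  define u where "u t = last (mv (map dec t))" for t
  have pos: "position u t = mv (map dec t)" for t
    unfolding u_def mv_def moves_map by (rule position_moves)
  have codes: "set (map dec t) \<subseteq> Q A \<times> UNIV" for t using range_dec by auto
  have u_snoc: "u (t @ [k]) = M (mv (map dec t)) (fst (dec k)) (snd (dec k))" for t k
    by (simp add: u_def mv_def case_prod_beta)
  have legal: "legal_reply F (position u t) (u (t @ [k])) p" for t k
  proof -
    have "fst (dec k) \<in> Q A" using range_dec by (metis mem_Times_iff rangeI)
    then show ?thesis
      using BRM_mv[OF codes] unfolding pos u_snoc \<Phi>_def by blast
  qed
  have "\<exists>r\<in>cohen \<kappa>. cohen_le r q \<and>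
      (\<exists>t k. cohen_le r (cohen_node \<alpha> (t @ [k])) \<and> (\<exists>x\<in>W. in_sub x (u (t @ [k])) r))"
    if q: "q \<in> cohen \<kappa>" "cohen_le q p" and W: "openin X W" "W \<noteq> {}" for q W
  proof -
    have "finite {i. (\<alpha>, i) \<in> dom q}"
      using q(1) finite_vimageI[of "dom q" "Pair \<alpha>"] by (auto simp: cohen_def vimage_def inj_on_def)
    then obtain m where m: "\<And>i. (\<alpha>, i) \<in> dom q \<Longrightarrow> i < m"
      using finite_nat_set_iff_bounded by auto
    obtain r t where r: "r \<in> cohen \<kappa>" "cohen_le r q" "cohen_le r (cohen_node \<alpha> t)" "length t = m"
      and dom_r: "dom r = dom q \<union> {\<alpha>} \<times> {..<m}"
      using cohen_extend_to_node[OF q(1) \<alpha>(1)] by metis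
    have fresh: "(\<alpha>, m) \<notin> dom r" using m dom_r by fastforce
    \<comment> \<open>The part of \<open>r\<close> that labels of the tree can speak about.\<close>
    define q0 where "q0 = r |` (A \<times> UNIV)"
    have rp: "cohen_le r p" using le_trans[OF r(1) q(1) p r(2) q(2)] .
    have q0: "q0 \<in> Q A"
      unfolding Q_def
    proof (intro CollectI conjI)
      show "q0 \<in> cohen \<kappa>" using r(1) unfolding q0_def cohen_def by auto
      show "cohen_le q0 p"
        using rp A(2) unfolding q0_def cohen_le_def map_le_def restrict_map_def by force
      show "dom q0 \<subseteq> A \<times> UNIV" unfolding q0_def by auto
    qed
    let ?L = "mv (map dec t)"
    have \<Phi>: "\<Phi> ?L q0 (B ?L q0) (R ?L q0) (M ?L q0)"
      using BRM_mv[OF codes q0] .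
    have "W \<subseteq> X closure_of (\<Union>n. B ?L q0 n)"
      using \<Phi> openin_subset[OF W(1)] unfolding \<Phi>_def by blast
    then obtain n x where x: "x \<in> B ?L q0 n" "x \<in> W"
      using W unfolding in_closure_of subset_iff by blast
    obtain k where k: "dec k = (q0, n)"
      using range_dec q0 by (metis (no_types, lifting) UNIV_I mem_Sigma_iff rangeE)
    define r' where "r' = R ?L q0 n"
    have r': "r' \<in> cohen \<kappa>" "cohen_le r' q0" "in_sub x (M ?L q0 n) r'"
      using \<Phi> x unfolding \<Phi>_def r'_def by blast+
    have r'_dom: "dom r' \<subseteq> A \<times> UNIV" unfolding r'_def by (rule R_supp[OF codes q0])
    \<comment> \<open>Over \<open>A\<close>, \<open>r'\<close> extends \<open>r\<close>; it has no values elsewhere. And \<open>(\<alpha>, m)\<close> is in neither domain.\<close>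
    define z where "z = (r ++ r')((\<alpha>, m) \<mapsto> k)"
    have z_in: "z \<in> cohen \<kappa>"
      using r(1) r'(1) \<alpha>(1) unfolding z_def cohen_def by auto
    have zr': "cohen_le z r'"
      using r'_dom \<alpha>(2) unfolding z_def cohen_le_def map_le_def by auto
    have zr: "cohen_le z r"
      unfolding cohen_le_def map_le_def
    proof
      fix c assume c: "c \<in> dom r"
      show "r c = z c"
      proof (cases "c \<in> dom r'")
        case True
        then have "c \<in> A \<times> UNIV" using r'_dom by blast
        then have "q0 c = r c" "c \<in> dom q0" using c by (auto simp: q0_def)
        then have "r' c = r c" using r'(2) by (auto simp: cohen_le_def map_le_def)
        moreover have "z c = r' c"
          using True zr' by (simp add: cohen_le_def map_le_def)
        ultimately show ?thesis by simp
      next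
        case False
        then show ?thesis using c fresh by (auto simp: z_def map_add_dom_app_simps)
      qed
    qed
    have "cohen_le z (cohen_node \<alpha> (t @ [k]))"
      unfolding cohen_node_le_iff
    proof (intro allI impI)
      fix i assume i: "i < length (t @ [k])"
      show "z (\<alpha>, i) = Some ((t @ [k]) ! i)"
      proof (cases "i < m")
        case True
        then have "r (\<alpha>, i) = Some (t ! i)" using r(3,4) by (simp add: cohen_node_le_iff)
        then show ?thesis
          using zr True r(4) by (force simp: cohen_le_def map_le_def nth_append)
      next
        case False
        then have "i = m" using i r(4) by simp
        then show ?thesis using r(4) by (simp add: z_def nth_append)
      qed
    qed
    moreover have "in_sub x (u (t @ [k])) z"
      using regular_mono[OF regular_in_sub r'(3,1) z_in zr'] by (simp add: u_snoc k)
    moreover have "cohen_le z q" using le_trans[OF z_in r(1) q(1) zr r(2)] .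
    ultimately show ?thesis using z_in x(2) by blast
  qed
  then have "TWO_wins X (branch u) p"
    using legal_reply_open[OF F p legal] by (intro TWO_wins_branch[OF p])
  moreover have "play_following X F (branch u) p"
    using play_following_branch[OF F p legal] .
  ultimately show ?thesis by blast
qed

theorem theorem11:
  fixes \<kappa> :: "'k rel" and X :: "'a topology"
  assumes "Card_order \<kappa>" and "natLeq <o \<kappa>"
    and "t1_space X" and "infinite (topspace X)"
    and "weakly_Lindelof X"
  shows "forcing_notion.holds_in_extension Map.empty
           (forcing_notion.no_winning_strategy_ONE (cohen \<kappa>) cohen_le X)"
proof -
  interpret forcing_notion "cohen \<kappa>" cohen_le Map.empty by (rule forcing_notion_cohen)
  have "topspace X \<noteq> {}" using assms(4) by auto
  then show ?thesis
    unfolding holds_in_extension_def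
    using cohen_real_defeats_strategy[OF uncountable_Field[OF assms(1,2)] _ assms(5)]
    by (intro no_winning_strategy_if_defeated[OF one_in]) blast
qed

end
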